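(* Consider system (5) in the standing setup with fixed $\sigma$ and weights, and suppose that the follower graph $\mathcal G^F_{\sigma(t)}$ is bidirectional for all $t\ge0$, i.e. for all $i,j\in\mathcal V_F$ and all $t\ge 0$, $(i,j)\in\mathcal E_{\sigma(t)}$ if and only if $(j,i)\in\mathcal E_{\sigma(t)}$ (the weights of $(i,j)$ and $(j,i)$ may differ). Then system (5) is SiISS with respect to $\mathcal L(y(t))$ if and only if $\mathcal G_{\sigma(t)}$ is jointly L-connected (JLC).
   Context: Standing setup. Fix integers $n\ge 2$, $k\ge 1$, $d\ge 1$. The follower set is $\mathcal V_F=\{1,\dots,n\}$ and the leader set is $\mathcal V_L=\{\hat 1,\dots,\hat k\}$ (disjoint from $\mathcal V_F$); $\mathcal V=\mathcal V_F\cup\mathcal V_L$. The interaction topology is a time-varying digraph $\mathcal G_{\sigma(t)}=(\mathcal V,\mathcal E_{\sigma(t)})$, where $\sigma:[0,\infty)\to\mathcal P$ is a piecewise constant switching signal taking values in a finite set $\mathcal P$ of digraphs on $\mathcal V$; no arc of any of these digraphs enters a leader. An arc $(j,i)$ means that $i$ receives information from $j$. Dwell-time assumption: any two consecutive switching instants of $\sigma$ are separated by at least $\tau_D>0$. For $i\in\mathcal V_F$, $N_i(\sigma(t))=\{j\in\mathcal V_F:(j,i)\in\mathcal E_{\sigma(t)}\}$ and $L_i(\sigma(t))=\{j\in\mathcal V_L:(j,i)\in\mathcal E_{\sigma(t)}\}$. $\mathcal G^F_{\sigma(t)}$ denotes the subgraph of $\mathcal G_{\sigma(t)}$ induced on $\mathcal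 V_F$. For $0\le t_1<t_2\le\infty$ the joint graph is $\mathcal G([t_1,t_2))=(\mathcal V,\bigcup_{t\in[t_1,t_2)}\mathcal E_{\sigma(t)})$, and $\mathcal G^F([t_1,t_2))$ is its subgraph induced on $\mathcal V_F$. System (5): $\dot y_i=u_i(y,t)$ for $i=1,\dots,k$, and $\dot x_i=\sum_{j\in N_i(\sigma(t))}a_{ij}(x,y,t)(x_j-x_i)+\sum_{j\in L_i(\sigma(t))}b_{ij}(x,y,t)(y_j-x_i)+w_i(t)$ for $i=1,\dots,n$, where $x_i,y_j\in\mathbb R^d$, $x=(x_1,\dots,x_n)$, $y=(y_1,\dots,y_k)$; each $u_i(y,t)$ is continuous in $y$ and piecewise continuous in $t$; each $w_i$ is continuous; the weights $a_{ij},b_{ij}$ are continuous and satisfy $a_*\le a_{ij}(x,y,t)\le a^*$, $b_{ij}(x,y,t)\ge b_*$ for all $x,y,t$, with constants $0<a_*\le a^*$, $b_*>0$. Initial time is $0$, $x^0=x(0)$, $y^0=y(0)$. Along a trajectory, $z(t)=(u_1(y(t),t),\dots,u_k(y(t),t),w_1(t),\dots,w_n(t))\in\mathbb R^{(n+k)d}$ and $\|z\|_\infty=\sup_{t\ge0}|z(t)|$. Set notation: $|\cdot|$ is the Euclidean norm; for a closed convex $K\subset\mathbb R^d$, $|v|_K=\inf_{p\in K}|v-p|$; $\mathcal L(y(t))=\mathrm{co}\{y_1(t),\dots,y_k(t)\}$ (convex hull); $|x(t)|_{\mathcal L(y(t))}=\max_{i\in\mathcal V_F}|x_i(t)|_{\mathcal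 L(y(t))}$. Connectivity: a digraph on $\mathcal V$ is L-connected if for every $i\in\mathcal V_F$ there is a directed path from some leader $j\in\mathcal V_L$ to $i$. $\mathcal G_{\sigma(t)}$ is jointly L-connected (JLC) if $\mathcal G([t,\infty))$ is L-connected for every $t\ge0$; it is uniformly jointly L-connected (UJLC) if there is $T>0$ such that $\mathcal G([t,t+T))$ is L-connected for every $t\ge0$. SiISS: system (5) is (globally, generalized) set integral-input-to-state stable with respect to $\mathcal L(y(t))$ if there exist a class-$\mathcal{KL}$ function $\beta$ and a class-$\mathcal K$ function $\gamma$ such that for all admissible $u_i,w_i$ and all initial conditions $x^0\in\mathbb R^{nd}$, $y^0\in\mathbb R^{kd}$: $|x(t)|_{\mathcal L(y(t))}\le\beta(|x^0|_{\mathcal L(y^0)},t)+\int_0^t\gamma(|z(s)|)\,ds$ for all $t\ge0$. *)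

theory Defs
  imports "HOL-Analysis.Analysis"
begin

text \<open>Vertices: followers are Inl i (i :: 'f, with n = CARD('f)),
  leaders are Inr j (j :: 'l, with k = CARD('l)).  A digraph on V is an
  arc set of type ('f + 'l) rel; an arc (p, q) means q receives from p.
  States in R^d are elements of real^'d (d = CARD('d)).\<close>

definition class_K :: "(real \<Rightarrow> real) \<Rightarrow> bool" where
  "class_K g \<longleftrightarrow> g 0 = 0 \<and> continuous_on {0..} g \<and> strict_mono_on {0..} g"

definition class_KL :: "(real \<Rightarrow> real \<Rightarrow> real) \<Rightarrow> bool" where
  "class_KL b \<longleftrightarrow>
     (\<forall>t\<ge>0. class_K (\<lambda>r. b r t)) \<and>
     (\<forall>r\<ge>0. antimono_on {0..} (\<lambda>t. b r t) \<and> ((\<lambda>t. b r t) \<longlongrightarrow> 0) at_top)"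

definition pw_continuous :: "(real \<Rightarrow> 'a::topological_space) \<Rightarrow> bool" where
  "pw_continuous f \<longleftrightarrow> (\<exists>S. (\<forall>T. finite (S \<inter> {..T})) \<and>
      (\<forall>t\<in>{0..} - S. continuous (at t within {0..}) f) \<and>
      (\<forall>t\<in>S. t \<ge> 0 \<longrightarrow> (\<exists>l. (f \<longlongrightarrow> l) (at_right t)) \<and>
                      (t > 0 \<longrightarrow> (\<exists>l. (f \<longlongrightarrow> l) (at_left t)))))"

definition dwell_signal ::
  "('f + 'l) rel set \<Rightarrow> real \<Rightarrow> (real \<Rightarrow> ('f + 'l) rel) \<Rightarrow> bool" where
  "dwell_signal P tauD sg \<longleftrightarrow> tauD > 0 \<and> (\<forall>t\<ge>0. sg t \<in> P) \<and>
     (\<exists>S. S \<subseteq> {0<..} \<and> (\<forall>s\<in>S. \<forall>s'\<in>S. s \<noteq> s' \<longrightarrow> tauD \<le> \<bar>s - s'\<bar>) \<and>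
          (\<forall>a b. 0 \<le> a \<longrightarrow> a \<le> b \<longrightarrow> {a<..b} \<inter> S = {} \<longrightarrow> sg b = sg a))"

definition no_arc_into_leader :: "('f + 'l) rel \<Rightarrow> bool" where
  "no_arc_into_leader G \<longleftrightarrow> (\<forall>(p, q)\<in>G. q \<in> range Inl)"

definition Nbr :: "('f + 'l) rel \<Rightarrow> 'f \<Rightarrow> 'f set" where
  "Nbr G i = {j. (Inl j, Inl i) \<in> G}"

definition LNbr :: "('f + 'l) rel \<Rightarrow> 'f \<Rightarrow> 'l set" where
  "LNbr G i = {j. (Inr j, Inl i) \<in> G}"

definition L_connected :: "('f + 'l) rel \<Rightarrow> bool" where
  "L_connected G \<longleftrightarrow> (\<forall>i. \<exists>j. (Inr j, Inl i) \<in> G\<^sup>+)"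

definition joint_graph :: "(real \<Rightarrow> ('f + 'l) rel) \<Rightarrow> real set \<Rightarrow> ('f + 'l) rel" where
  "joint_graph sg I = (\<Union>t\<in>I. sg t)"

definition JLC :: "(real \<Rightarrow> ('f + 'l) rel) \<Rightarrow> bool" where
  "JLC sg \<longleftrightarrow> (\<forall>t\<ge>0. L_connected (joint_graph sg {t..}))"

definition follower_bidirectional :: "(real \<Rightarrow> ('f + 'l) rel) \<Rightarrow> bool" where
  "follower_bidirectional sg \<longleftrightarrow>
     (\<forall>t\<ge>0. \<forall>i j. (Inl i, Inl j) \<in> sg t \<longleftrightarrow> (Inl j, Inl i) \<in> sg t)"

definition admissible ::
  "('l \<Rightarrow> (real^'d)^'l \<Rightarrow> real \<Rightarrow> real^'d) \<Rightarrow> ('f \<Rightarrow> real \<Rightarrow> real^'d) \<Rightarrow> bool" where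
  "admissible u w \<longleftrightarrow>
     (\<forall>i t. continuous_on UNIV (\<lambda>y. u i y t)) \<and>
     (\<forall>i y. pw_continuous (\<lambda>t. u i y t)) \<and>
     (\<forall>i. continuous_on {0..} (w i))"

definition leader_rhs ::
  "('l \<Rightarrow> (real^'d)^'l \<Rightarrow> real \<Rightarrow> real^'d) \<Rightarrow> (real \<Rightarrow> (real^'d)^'l) \<Rightarrow> real \<Rightarrow> (real^'d)^'l" where
  "leader_rhs u y s = (\<chi> i. u i (y s) s)"

definition follower_rhs ::
  "(real \<Rightarrow> ('f + 'l) rel) \<Rightarrow>
   ('f \<Rightarrow> 'f \<Rightarrow> (real^'d)^'f \<Rightarrow> (real^'d)^'l \<Rightarrow> real \<Rightarrow> real) \<Rightarrow>
   ('f \<Rightarrow> 'l \<Rightarrow> (real^'d)^'f \<Rightarrow> (real^'d)^'l \<Rightarrow> real \<Rightarrow> real) \<Rightarrow>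
   ('f \<Rightarrow> real \<Rightarrow> real^'d) \<Rightarrow>
   (real \<Rightarrow> (real^'d)^'f) \<Rightarrow> (real \<Rightarrow> (real^'d)^'l) \<Rightarrow> real \<Rightarrow> (real^'d)^'f" where
  "follower_rhs sg a b w x y s = (\<chi> i.
      (\<Sum>j\<in>Nbr (sg s) i. a i j (x s) (y s) s *\<^sub>R (x s $ j - x s $ i))
    + (\<Sum>j\<in>LNbr (sg s) i. b i j (x s) (y s) s *\<^sub>R (y s $ j - x s $ i))
    + w i s)"

text \<open>Trajectories (Caratheodory solutions on [0,oo)): the right-hand side
  is Lebesgue integrable on every [0,t] and the state is its indefinite integral.\<close>
definition is_solution where
  "is_solution sg a b u w x y \<longleftrightarrow>
     (\<forall>t\<ge>0. leader_rhs u y absolutely_integrable_on {0..t} \<and>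
             integral {0..t} (leader_rhs u y) = y t - y 0 \<and>
             follower_rhs sg a b w x y absolutely_integrable_on {0..t} \<and>
             integral {0..t} (follower_rhs sg a b w x y) = x t - x 0)"

definition leader_hull :: "(real^'d)^'l \<Rightarrow> (real^'d) set" where
  "leader_hull yv = convex hull (range (\<lambda>j. yv $ j))"

definition dist_hull :: "(real^'d)^'f::finite \<Rightarrow> (real^'d)^'l \<Rightarrow> real" where
  "dist_hull xv yv = Max (range (\<lambda>i. infdist (xv $ i) (leader_hull yv)))"

definition input_signal ::
  "('l \<Rightarrow> (real^'d)^'l \<Rightarrow> real \<Rightarrow> real^'d) \<Rightarrow> ('f \<Rightarrow> real \<Rightarrow> real^'d) \<Rightarrow>
   (real \<Rightarrow> (real^'d)^'l) \<Rightarrow> real \<Rightarrow> ((real^'d)^'l) \<times> ((real^'d)^'f)" where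
  "input_signal u w y s = (leader_rhs u y s, \<chi> i. w i s)"

definition SiISS where
  "SiISS sg a b \<longleftrightarrow>
     (\<exists>\<beta> \<gamma>. class_KL \<beta> \<and> class_K \<gamma> \<and>
       (\<forall>u w x y. admissible u w \<longrightarrow> is_solution sg a b u w x y \<longrightarrow>
          (\<forall>t\<ge>0. ennreal (dist_hull (x t) (y t)) \<le>
             ennreal (\<beta> (dist_hull (x 0) (y 0)) t) +
             (\<integral>\<^sup>+ s\<in>{0..t}. ennreal (\<gamma> (norm (input_signal u w y s))) \<partial>lborel))))"

end

theory Submission
  imports Defs "HOL-Complex_Analysis.Great_Picard"
begin

text \<open>
  If the graph is jointly L-connected, fix a vector \<open>p\<close> with \<open>norm p \<le> 1\<close> and follow the scalars
  \<open>p \<bullet> x\<^sub>i\<close> relative to the initial support value of the leaders plus \<open>\<integral>|z|\<close>. Whenever they are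
  nonnegative they satisfy the linear consensus inequality without input. Let \<open>M\<close> bound them and
  let \<open>S\<close> be the set of followers already below \<open>M (1 - \<delta>)\<close>. While no arc joins \<open>S\<close> to the other
  followers, in either direction by bidirectionality, this bound is kept for an arbitrarily long
  time; once an arc from a leader or from \<open>S\<close> reaches a new follower, the dwell time makes
  it last long enough to pull that follower below \<open>M (1 - \<rho>\<delta>)\<close> with a uniform \<open>\<rho>\<close>. After \<open>n\<close>
  recruitments the bound has contracted by a fixed factor, over a time window that depends on \<open>\<sigma>\<close>
  only. The dual description of the distance to the hull turns this into the SiISS estimate with
  a linear gain.

  Conversely, if from \<open>t\<^sub>0\<close> on some set \<open>U\<close> of followers is not reachable from the leaders, put the
  leaders at \<open>0\<close>, all followers at a unit vector, and all inputs to \<open>0\<close>. A solution exists by a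
  Peano argument, the followers are still away from \<open>0\<close> at \<open>t\<^sub>0\<close>, and those in \<open>U\<close> stay away
  forever, which no class-KL bound allows.
\<close>

section \<open>Integral comparison\<close>

lemma has_integral_Icc_diff:
  fixes g :: "real \<Rightarrow> 'a::banach"
  assumes "(g has_integral A) {s..r}" "(g has_integral B) {s..q}" "s \<le> q" "q \<le> r"
  shows "(g has_integral A - B) {q..r}"
proof -
  have "g integrable_on {q..r}"
    using integrable_on_subinterval[of g "{s..r}" q r] assms by auto
  then have "(g has_integral integral {q..r} g) {q..r}"
    by (rule integrable_integral)
  moreover have "(g has_integral B + integral {q..r} g) {s..r}"
    using has_integral_combine[OF assms(3,4,2) calculation] .
  then have "A = B + integral {q..r} g"
    using has_integral_unique assms(1) by blast
  ultimately show ?thesis by simp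
qed

lemma continuous_on_of_has_integral:
  fixes g :: "real \<Rightarrow> 'a::banach"
  assumes "\<And>r. r \<in> {s..t} \<Longrightarrow> (g has_integral v r - v s) {s..r}"
  shows "continuous_on {s..t} v"
proof (cases "s \<le> t")
  case True
  then have "g integrable_on {s..t}" using assms[of t] by auto
  then have "continuous_on {s..t} (\<lambda>r. v s + integral {s..r} g)"
    by (intro continuous_intros indefinite_integral_continuous_1)
  moreover have "v s + integral {s..r} g = v r" if "r \<in> {s..t}" for r
    using integral_unique[OF assms[OF that]] by simp
  ultimately show ?thesis by (rule continuous_on_eq)
qed simp

text \<open>Each positive part satisfies \<open>max 0 (v i r) \<le> \<integral> K m\<close> over \<open>[s, r]\<close>, where \<open>m\<close> is the sum
  of the positive parts: integrate from the last zero of \<open>v i\<close>. Gronwall then forces \<open>m = 0\<close>.\<close>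
lemma integral_comparison:
  fixes v g :: "'i::finite \<Rightarrow> real \<Rightarrow> real"
  assumes K: "0 \<le> K"
    and I: "\<And>i r. r \<in> {s..t} \<Longrightarrow> (g i has_integral v i r - v i s) {s..r}"
    and init: "\<And>i. v i s \<le> 0"
    and step: "\<And>i r. r \<in> {s..t} \<Longrightarrow> 0 \<le> v i r \<Longrightarrow> g i r \<le> K * (\<Sum>j\<in>UNIV. max 0 (v j r))"
    and r: "r \<in> {s..t}"
  shows "v i r \<le> 0"
proof -
  define m where "m q = (\<Sum>j\<in>UNIV. max 0 (v j q))" for q
  define L where "L = real CARD('i) * K"
  define J where "J q = integral {s..q} m" for q
  have L0: "0 \<le> L" using K by (simp add: L_def)
  have cv: "continuous_on {s..t} (v i)" for i
    using I by (rule continuous_on_of_has_integral)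
  have cm: "continuous_on {s..t} m"
    unfolding m_def by (intro continuous_intros cv)
  have m0: "0 \<le> m q" for q unfolding m_def by (simp add: sum_nonneg)
  have mint: "m integrable_on {p..q}" if "s \<le> p" "q \<le> t" for p q
    using that by (intro integrable_continuous_real continuous_on_subset[OF cm]) auto
  \<comment> \<open>Where \<open>m\<close> is not known to be integrable, \<open>integral\<close>
    defaults to 0 and the bound still holds.\<close>
  have J0: "0 \<le> J q" for q
    unfolding J_def by (cases "m integrable_on {s..q}")
      (auto intro!: integral_nonneg m0 simp: not_integrable_integral)
  have key: "max 0 (v i q) \<le> K * J q" if q: "q \<in> {s..t}" for i :: 'i and q
  proof (cases "v i q \<le> 0")
    case True
    then show ?thesis using J0 K by simp
  next
    case False
    define Z where "Z = {p \<in> {s..q}. v i p \<le> 0}"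
    have cq: "continuous_on {s..q} (v i)" by (rule continuous_on_subset[OF cv]) (use q in auto)
    have "closed Z" unfolding Z_def
      by (rule continuous_on_closed_Collect_le) (auto intro: cq)
    moreover have "bounded Z" unfolding Z_def
      by (rule bounded_subset[OF bounded_closed_interval[of s q]]) auto
    ultimately have "compact Z" by (simp add: compact_eq_bounded_closed)
    moreover have "s \<in> Z" using init q by (auto simp: Z_def)
    ultimately obtain p where p: "p \<in> Z" "\<And>p'. p' \<in> Z \<Longrightarrow> p' \<le> p"
      using compact_attains_sup[of Z] by blast
    have sp: "s \<le> p" "p \<le> q" using p by (auto simp: Z_def)
    \<comment> \<open>\<open>p\<close> is the last time in \<open>[s, q]\<close> with
      \<open>v i \<le> 0\<close>. The intermediate value theorem gives a zero at or after
      \<open>p\<close>, which by maximality is \<open>p\<close> itself; hence \<open>v i\<close> is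
      nonnegative from \<open>p\<close> on.\<close>
    have "\<exists>x\<ge>p. x \<le> q \<and> v i x = 0"
      using p False sp by (intro IVT' continuous_on_subset[OF cq]) (auto simp: Z_def)
    then obtain x where x: "p \<le> x" "x \<le> q" "v i x = 0" by blast
    then have "x \<in> Z" using sp by (auto simp: Z_def)
    then have vp: "v i p = 0" using p x by (metis antisym)
    have pos: "0 \<le> v i p'" if "p' \<in> {p..q}" for p'
      using p(2)[of p'] that vp sp by (cases "p' = p") (force simp: Z_def)+
    have gi: "(g i has_integral v i q) {p..q}"
      using has_integral_Icc_diff[OF I[of q i] I[of p i]] q sp vp by auto
    have "v i q \<le> integral {p..q} (\<lambda>x. K * m x)"
    proof (rule has_integral_le[OF gi integrable_integral])
      show "(\<lambda>x. K * m x) integrable_on {p..q}"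
        using mint[of p q] sp q by (intro integrable_on_mult_right) auto
      show "g i x \<le> K * m x" if "x \<in> {p..q}" for x
        unfolding m_def by (rule step[OF _ pos[OF that]]) (use that sp q in auto)
    qed
    also have "\<dots> = K * integral {p..q} m" by simp
    also have "\<dots> \<le> K * J q"
      unfolding J_def using sp q m0 mint K
      by (intro mult_left_mono integral_subset_le) auto
    finally show ?thesis using J0 K by simp
  qed
  have mL: "m q \<le> L * J q" if "q \<in> {s..t}" for q
  proof -
    have "m q \<le> (\<Sum>j\<in>(UNIV::'i set). K * J q)"
      unfolding m_def by (rule sum_mono) (rule key[OF that])
    then show ?thesis by (simp add: L_def)
  qed
  have dJ: "(J has_real_derivative m q) (at q)" if "q \<in> {s<..<t}" for q
    using integral_has_real_derivative[OF cm, of q] that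
    by (simp add: J_def[abs_def] at_within_Icc_at)
  \<comment> \<open>Gronwall: \<open>J' = m \<le> L * J\<close> makes
    \<open>exp (- L * q) * J q\<close> nonincreasing, and \<open>J s = 0\<close>.\<close>
  have "exp (- L * r) * J r \<le> exp (- L * s) * J s"
  proof (rule DERIV_nonpos_imp_decreasing_open[where f = "\<lambda>q. exp (- L * q) * J q"])
    show "s \<le> r" using r by simp
    have "continuous_on {s..t} J" unfolding J_def
      using mint r by (intro indefinite_integral_continuous_1) auto
    then show "continuous_on {s..r} (\<lambda>q. exp (- L * q) * J q)"
      by (intro continuous_intros, rule continuous_on_subset) (use r in auto)
    fix q assume q: "s < q" "q < r"
    have "((\<lambda>q. exp (- L * q) * J q) has_real_derivative exp (- L * q) * (m q - L * J q)) (at q)"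
      using dJ[of q] q r by (auto intro!: derivative_eq_intros simp: algebra_simps)
    moreover have "exp (- L * q) * (m q - L * J q) \<le> 0"
      using mL[of q] q r by (simp add: mult_le_0_iff)
    ultimately show "\<exists>y. ((\<lambda>q. exp (- L * q) * J q) has_real_derivative y) (at q) \<and> y \<le> 0"
      by blast
  qed
  then have "J r \<le> 0" by (simp add: J_def mult_le_0_iff)
  then show ?thesis using key[OF r, of i] mult_nonneg_nonpos[OF K, of "J r"] by simp
qed

section \<open>Barriers for the consensus inequality\<close>

text \<open>State-dependent weights become arbitrary functions of time within fixed bounds, and all
  leaders merge into one damping rate \<open>\<kappa>\<close>; constants derived from this are
  therefore uniform over trajectories. Leaders count as level 0 and only the excess above them
  matters, so the inequality is asked only where \<open>v i r\<close> is nonnegative and neighbours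
  enter through their positive parts.\<close>

definition subsolution ::
  "(real \<Rightarrow> ('f + 'l) rel) \<Rightarrow> real \<Rightarrow> real \<Rightarrow> real \<Rightarrow> ('f \<Rightarrow> real \<Rightarrow> real) \<Rightarrow> bool" where
  "subsolution sg alo ahi blo v \<longleftrightarrow> (\<exists>g \<alpha> \<kappa>.
     (\<forall>i. \<forall>r\<ge>0. (g i has_integral v i r - v i 0) {0..r}) \<and>
     (\<forall>i j r. alo \<le> \<alpha> i j r \<and> \<alpha> i j r \<le> ahi) \<and>
     (\<forall>i r. 0 \<le> \<kappa> i r \<and> (LNbr (sg r) i \<noteq> {} \<longrightarrow> blo \<le> \<kappa> i r)) \<and>
     (\<forall>i. \<forall>r\<ge>0. 0 \<le> v i r \<longrightarrow>
        g i r \<le> (\<Sum>j\<in>Nbr (sg r) i. \<alpha> i j r * (max 0 (v j r) - v i r)) - \<kappa> i r * v i r))"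

text \<open>Barrier principle: the excess \<open>v - B\<close> over a supersolution fits
  \<open>integral_comparison\<close> with \<open>K = ahi\<close>. The condition \<open>super\<close>
  ranges over all weights within the bounds because those of \<open>v\<close> are unknown. The
  interval is half-open since the graph may switch at \<open>t\<close>; the end point follows by
  continuity.\<close>

lemma subsolution_le_affine:
  fixes v :: "'f::finite \<Rightarrow> real \<Rightarrow> real"
  assumes sub: "subsolution sg alo ahi blo v" and alo: "0 \<le> alo" and ahi: "0 \<le> ahi"
    and st: "0 \<le> s" "s \<le> t"
    and B: "\<And>i r. B i r = p i + d i * (r - s)"
    and init: "\<And>i. v i s \<le> p i"
    and B0: "\<And>i r. r \<in> {s..<t} \<Longrightarrow> 0 \<le> B i r"
    and super: "\<And>i r \<alpha> \<kappa>. r \<in> {s..<t} \<Longrightarrow> (\<And>j. alo \<le> \<alpha> j \<and> \<alpha> j \<le> ahi) \<Longrightarrow> 0 \<le> \<kappa> \<Longrightarrow>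
        (LNbr (sg r) i \<noteq> {} \<Longrightarrow> blo \<le> \<kappa>) \<Longrightarrow>
        (\<Sum>j\<in>Nbr (sg r) i. \<alpha> j * (B j r - B i r)) - \<kappa> * B i r \<le> d i"
  shows "v i t \<le> B i t"
proof -
  from sub obtain g \<alpha> \<kappa> where
    g: "\<And>i r. 0 \<le> r \<Longrightarrow> (g i has_integral v i r - v i 0) {0..r}"
    and \<alpha>: "\<And>i j r. alo \<le> \<alpha> i j r \<and> \<alpha> i j r \<le> ahi"
    and \<kappa>: "\<And>i r. 0 \<le> \<kappa> i r" "\<And>i r. LNbr (sg r) i \<noteq> {} \<Longrightarrow> blo \<le> \<kappa> i r"
    and gle: "\<And>i r. 0 \<le> r \<Longrightarrow> 0 \<le> v i r \<Longrightarrow>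
      g i r \<le> (\<Sum>j\<in>Nbr (sg r) i. \<alpha> i j r * (max 0 (v j r) - v i r)) - \<kappa> i r * v i r"
    unfolding subsolution_def by blast
  define v' where "v' i r = v i r - B i r" for i r
  have gs: "(g i has_integral v i r - v i s) {s..r}" if "s \<le> r" for i r
    using has_integral_Icc_diff[OF g[of r i] g[of s i]] st that by auto
  have g': "((\<lambda>r. g i r - d i) has_integral v' i r - v' i s) {s..r}" if "s \<le> r" for i r
  proof -
    have "((\<lambda>r. g i r - d i) has_integral (v i r - v i s) - (r - s) *\<^sub>R d i) {s..r}"
      by (intro has_integral_diff gs has_integral_const_real[THEN has_integral_eq_rhs] that)
        (use that in auto)
    then show ?thesis by (simp add: v'_def B algebra_simps)
  qed
  have le: "v' i r \<le> 0" if r: "r \<in> {s..<t}" for i r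
  proof (rule integral_comparison[where v = v' and i = i and r = r and K = ahi and s = s and t = r
        and g = "\<lambda>i r. g i r - d i"])
    show "v' i s \<le> 0" for i using init[of i] by (simp add: v'_def B)
    show "((\<lambda>r. g i r - d i) has_integral v' i q - v' i s) {s..q}" if "q \<in> {s..r}" for i q
      using g' that by simp
    show "r \<in> {s..r}" using r by simp
    fix i q assume q: "q \<in> {s..r}" and v0: "0 \<le> v' i q"
    have q': "q \<in> {s..<t}" "0 \<le> q" using q r st by auto
    have vi: "B i q \<le> v i q" "0 \<le> v i q" using v0 B0[OF q'(1), of i] by (auto simp: v'_def)
    have "g i q \<le> (\<Sum>j\<in>Nbr (sg q) i. \<alpha> i j q * (max 0 (v j q) - v i q)) - \<kappa> i q * v i q"
      using gle q' vi by blast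
    also have "\<dots> \<le> (\<Sum>j\<in>Nbr (sg q) i. \<alpha> i j q * (B j q - B i q) + ahi * max 0 (v' j q)) - \<kappa> i q * B i q"
    proof (intro diff_mono sum_mono mult_left_mono vi \<kappa>)
      fix j
      \<comment> \<open>Since \<open>B j q\<close> is nonnegative,
        \<open>max 0 (v j q) \<le> B j q + max 0 (v' j q)\<close>; and
        \<open>- v i q \<le> - B i q\<close> by \<open>vi\<close>.\<close>
      have "max 0 (v j q) - v i q \<le> (B j q - B i q) + max 0 (v' j q)"
        using vi B0[OF q'(1), of j] by (auto simp: v'_def)
      then have "\<alpha> i j q * (max 0 (v j q) - v i q) \<le> \<alpha> i j q * ((B j q - B i q) + max 0 (v' j q))"
        using \<alpha>[of i j q] alo by (intro mult_left_mono) auto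
      also have "\<dots> \<le> \<alpha> i j q * (B j q - B i q) + ahi * max 0 (v' j q)"
        using \<alpha>[of i j q] by (auto simp: distrib_left intro!: mult_right_mono)
      finally show "\<alpha> i j q * (max 0 (v j q) - v i q) \<le> \<alpha> i j q * (B j q - B i q) + ahi * max 0 (v' j q)" .
    qed
    also have "\<dots> = ((\<Sum>j\<in>Nbr (sg q) i. \<alpha> i j q * (B j q - B i q)) - \<kappa> i q * B i q)
        + ahi * (\<Sum>j\<in>Nbr (sg q) i. max 0 (v' j q))"
      by (simp add: sum.distrib sum_distrib_left)
    also have "\<dots> \<le> d i + ahi * (\<Sum>j\<in>UNIV. max 0 (v' j q))"
      by (intro add_mono mult_left_mono super sum_mono2 ahi) (use q' \<alpha> \<kappa> in auto)
    finally show "g i q - d i \<le> ahi * (\<Sum>j\<in>UNIV. max 0 (v' j q))" by simp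
  qed (use ahi in auto)
  show ?thesis
  proof (cases "s = t")
    case True
    then show ?thesis using init[of i] by (simp add: B)
  next
    case False
    have c: "continuous_on {s..t} (\<lambda>r. - v' i r)"
      by (intro continuous_intros continuous_on_of_has_integral[OF g']) auto
    have "0 \<le> - v' i t"
      by (rule continuous_ge_on_Ioo[OF c]) (use le False st in auto)
    then show ?thesis by (simp add: v'_def)
  qed
qed

text \<open>Maximum principle: for equal barrier values the neighbour terms vanish, and damping only
  pulls down.\<close>

lemma subsolution_le_const:
  fixes v :: "'f::finite \<Rightarrow> real \<Rightarrow> real"
  assumes "subsolution sg alo ahi blo v" "0 \<le> alo" "alo \<le> ahi" "0 \<le> s" "s \<le> t" "0 \<le> M"
    "\<And>i. v i s \<le> M"
  shows "v i t \<le> M"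
  by (rule subsolution_le_affine[OF assms(1), where B = "\<lambda>_ _. M" and p = "\<lambda>_. M" and d = "\<lambda>_. 0"
        and s = s])
    (use assms in auto)

lemma sum_weights_le:
  fixes x :: "'f::finite \<Rightarrow> real"
  assumes "\<And>j. 0 \<le> \<alpha> j \<and> \<alpha> j \<le> c" "0 \<le> c" "0 \<le> e" "\<And>j. j \<in> N \<Longrightarrow> x j \<le> e"
  shows "(\<Sum>j\<in>N. \<alpha> j * x j) \<le> real CARD('f) * c * e"
proof -
  have "(\<Sum>j\<in>N. \<alpha> j * x j) \<le> (\<Sum>j\<in>N. c * e)"
  proof (rule sum_mono)
    fix j assume "j \<in> N"
    then have "\<alpha> j * x j \<le> \<alpha> j * e" using assms by (intro mult_left_mono) auto
    also have "\<dots> \<le> c * e" using assms by (intro mult_right_mono) auto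
    finally show "\<alpha> j * x j \<le> c * e" .
  qed
  also have "\<dots> \<le> (\<Sum>j\<in>(UNIV::'f set). c * e)"
    using assms by (intro sum_mono2) auto
  finally show ?thesis by simp
qed

text \<open>Whatever the graph does, a member of \<open>S\<close> is pulled up towards
  \<open>M\<close> with total weight at most \<open>K\<close>. Over a time with
  \<open>K * (t - s) \<le> 1 / 2\<close> it loses at most half of its margin
  \<open>M * \<delta>\<close>.\<close>

lemma subsolution_leak:
  fixes v :: "'f::finite \<Rightarrow> real \<Rightarrow> real"
  assumes sub: "subsolution sg alo ahi blo v" and a: "0 \<le> alo" "alo \<le> ahi"
    and K: "K = real CARD('f) * ahi" "K * (t - s) \<le> 1 / 2"
    and st: "0 \<le> s" "s \<le> t" and M: "0 \<le> M" and \<delta>: "0 \<le> \<delta>" "\<delta> \<le> 1"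
    and init: "\<And>i. v i s \<le> M" "\<And>i. i \<in> S \<Longrightarrow> v i s \<le> M * (1 - \<delta>)"
    and i: "i \<in> S"
  shows "v i t \<le> M * (1 - \<delta> / 2)"
proof -
  define p where "p i = (if i \<in> S then M * (1 - \<delta>) else M)" for i
  \<comment> \<open>The slope on \<open>S\<close> is \<open>K\<close> times the largest possible gap
    \<open>M * \<delta>\<close> between the barrier and \<open>M\<close>.\<close>
  define d where "d i = (if i \<in> S then M * \<delta> * K else 0)" for i
  define B where "B i r = p i + d i * (r - s)" for i r
  have K0: "0 \<le> K" using K a by simp
  have BS: "B i r = M - M * \<delta> * (1 - K * (r - s))" if "i \<in> S" for i r
    using that by (simp add: B_def p_def d_def algebra_simps)
  have BnS: "B i r = M" if "i \<notin> S" for i r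
    using that by (simp add: B_def p_def d_def)
  have Kr: "0 \<le> K * (r - s) \<and> K * (r - s) \<le> 1 / 2" if "r \<in> {s..<t}" for r
    using that K0 K(2) mult_left_mono[of "r - s" "t - s" K] by auto
  have MB: "0 \<le> M - B i r \<and> M - B i r \<le> M * \<delta>" if "r \<in> {s..<t}" for i r
  proof (cases "i \<in> S")
    case True
    have "M * \<delta> * (1 - K * (r - s)) \<le> M * \<delta> * 1"
      using Kr[OF that] M \<delta> by (intro mult_left_mono) auto
    then show ?thesis using Kr[OF that] M \<delta> by (simp add: BS[OF True])
  next
    case False
    then show ?thesis using M \<delta> by (simp add: BnS)
  qed
  have B0: "0 \<le> B i r" if "r \<in> {s..<t}" for i r
    using MB[OF that, of i] mult_left_mono[OF \<delta>(2) M] by simp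
  have "v i t \<le> B i t"
  proof (rule subsolution_le_affine[OF sub a(1) _ st B_def])
    show "0 \<le> ahi" using a by simp
    show "v i s \<le> p i" for i using init by (simp add: p_def)
    show "r \<in> {s..<t} \<Longrightarrow> 0 \<le> B i r" for i r by (rule B0)
    fix i :: 'f and r and \<alpha> :: "'f \<Rightarrow> real" and \<kappa> :: real
    assume r: "r \<in> {s..<t}" and \<alpha>: "\<And>j. alo \<le> \<alpha> j \<and> \<alpha> j \<le> ahi" and \<kappa>: "0 \<le> \<kappa>"
    have "(\<Sum>j\<in>Nbr (sg r) i. \<alpha> j * (B j r - B i r)) \<le> K * (M - B i r)"
      unfolding K(1) using MB[OF r] a order_trans[OF a(1)] \<alpha> by (intro sum_weights_le) auto
    also have "\<dots> \<le> d i"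
    proof (cases "i \<in> S")
      case True
      then show ?thesis using mult_left_mono[OF conjunct2[OF MB[OF r, of i]] K0]
        by (simp add: d_def mult_ac)
    qed (simp add: BnS d_def)
    finally show "(\<Sum>j\<in>Nbr (sg r) i. \<alpha> j * (B j r - B i r)) - \<kappa> * B i r \<le> d i"
      using mult_nonneg_nonneg[OF \<kappa> B0[OF r, of i]] by linarith
  qed
  also have "\<dots> = M - M * \<delta> * (1 - K * (t - s))" by (rule BS[OF i])
  also have "\<dots> \<le> M - M * \<delta> * (1 / 2)"
    using K(2) M \<delta> by (intro diff_mono mult_left_mono) auto
  finally show ?thesis by (simp add: algebra_simps)
qed

text \<open>Without arcs entering \<open>S\<close> from outside, the two-level barrier is
  stationary. This bridges the wait for the next crossing arc, which has no a priori bound.\<close>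

lemma subsolution_isolated:
  fixes v :: "'f::finite \<Rightarrow> real \<Rightarrow> real"
  assumes sub: "subsolution sg alo ahi blo v" and a: "0 \<le> alo" "alo \<le> ahi"
    and st: "0 \<le> s" "s \<le> t" and M: "0 \<le> M" and \<delta>: "0 \<le> \<delta>" "\<delta> \<le> 1"
    and iso: "\<And>r i. r \<in> {s..<t} \<Longrightarrow> i \<in> S \<Longrightarrow> Nbr (sg r) i \<subseteq> S"
    and init: "\<And>i. v i s \<le> M" "\<And>i. i \<in> S \<Longrightarrow> v i s \<le> M * (1 - \<delta>)"
    and i: "i \<in> S"
  shows "v i t \<le> M * (1 - \<delta>)"
proof -
  define p where "p i = (if i \<in> S then M * (1 - \<delta>) else M)" for i
  have M\<delta>: "M * (1 - \<delta>) \<le> M" using M \<delta> by (simp add: mult_left_le)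
  have p0: "0 \<le> p i" for i using M \<delta> by (simp add: p_def)
  have "v i t \<le> p i"
  proof (rule subsolution_le_affine[OF sub a(1) _ st, where B = "\<lambda>i r. p i" and d = "\<lambda>_. 0"])
    show "v i s \<le> p i" for i using init by (simp add: p_def)
    fix i :: 'f and r and \<alpha> :: "'f \<Rightarrow> real" and \<kappa> :: real
    assume r: "r \<in> {s..<t}" and \<alpha>: "\<And>j. alo \<le> \<alpha> j \<and> \<alpha> j \<le> ahi" and \<kappa>: "0 \<le> \<kappa>"
    have "(\<Sum>j\<in>Nbr (sg r) i. \<alpha> j * (p j - p i)) \<le> 0"
    proof (rule sum_nonpos)
      fix j assume "j \<in> Nbr (sg r) i"
      then have "p j \<le> p i" using iso[OF r] M\<delta> by (auto simp: p_def)
      then show "\<alpha> j * (p j - p i) \<le> 0"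
        using order_trans[OF a(1)] \<alpha> by (simp add: mult_nonneg_nonpos)
    qed
    then show "(\<Sum>j\<in>Nbr (sg r) i. \<alpha> j * (p j - p i)) - \<kappa> * p i \<le> 0"
      using mult_nonneg_nonneg[OF \<kappa> p0[of i]] by linarith
  qed (use a p0 in auto)
  then show ?thesis using i by (simp add: p_def)
qed

text \<open>An arc from \<open>S\<close> or from a leader that is present throughout
  \<open>[s, s + h)\<close> pulls \<open>q\<close> down at rate at least
  \<open>M * \<delta> * c\<close>. The barrier rises on \<open>S\<close> as in
  \<open>subsolution_leak\<close>, falls linearly at \<open>q\<close>, and stays at \<open>M\<close>
  elsewhere.\<close>

lemma subsolution_gain:
  fixes v :: "'f::finite \<Rightarrow> real \<Rightarrow> real"
  assumes sub: "subsolution sg alo ahi blo v" and a: "0 < alo" "alo \<le> ahi"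
    and K: "K = real CARD('f) * ahi" "K * h \<le> 1 / 2" and h: "0 \<le> h"
    and c: "c = min alo blo / 3" "0 < c"
    and s: "0 \<le> s" and M: "0 \<le> M" and \<delta>: "0 \<le> \<delta>" "\<delta> \<le> 1"
    and arc: "\<And>r. r \<in> {s..<s + h} \<Longrightarrow> Nbr (sg r) q \<inter> S \<noteq> {} \<or> LNbr (sg r) q \<noteq> {}"
    and q: "q \<notin> S"
    and init: "\<And>i. v i s \<le> M" "\<And>i. i \<in> S \<Longrightarrow> v i s \<le> M * (1 - \<delta>)"
  shows "v q (s + h) \<le> M * (1 - \<delta> * c * h)"
proof -
  define p where "p i = (if i \<in> S then M * (1 - \<delta>) else M)" for i
  define d where "d i = (if i \<in> S then M * \<delta> * K else if i = q then - M * \<delta> * c else 0)" for i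
  define B where "B i r = p i + d i * (r - s)" for i r
  have K0: "0 \<le> K" and aK: "alo \<le> K"
    using K(1) a mult_mono[of 1 "real CARD('f)" alo ahi] by (simp_all add: Suc_leI)
  have "c * h \<le> K * h" using aK c a h by (intro mult_right_mono) auto
  then have ch: "c * h \<le> 1 / 2" using K by simp
  have BS: "B i r = M - M * \<delta> * (1 - K * (r - s))" if "i \<in> S" for i r
    using that by (simp add: B_def p_def d_def algebra_simps)
  have Bq: "B q r = M - M * \<delta> * (c * (r - s))" for r
    using q by (simp add: B_def p_def d_def algebra_simps)
  have Bn: "B i r = M" if "i \<notin> S" "i \<noteq> q" for i r
    using that by (simp add: B_def p_def d_def)
  have r_bnd: "0 \<le> K * (r - s) \<and> K * (r - s) \<le> 1 / 2 \<and> 0 \<le> c * (r - s) \<and> c * (r - s) \<le> 1 / 2 \<and>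
      c * (K * (r - s)) \<le> c * (1 / 2)"
    if "r \<in> {s..<s + h}" for r
  proof -
    have "0 \<le> r - s" "r - s \<le> h" using that by auto
    then have "0 \<le> K * (r - s)" "K * (r - s) \<le> K * h" "0 \<le> c * (r - s)" "c * (r - s) \<le> c * h"
      using K0 c(2) by (auto intro: mult_left_mono)
    moreover from this have "K * (r - s) \<le> 1 / 2" "c * (r - s) \<le> 1 / 2"
      using K(2) ch by linarith+
    ultimately show ?thesis using c(2) by (intro conjI mult_left_mono) auto
  qed
  have M\<delta>: "0 \<le> M * \<delta>" "M * \<delta> \<le> M" using M \<delta> by (auto simp: mult_left_le)
  have MB: "0 \<le> M - B i r \<and> M - B i r \<le> M * \<delta>" if "r \<in> {s..<s + h}" for i r
  proof -
    have "M * \<delta> * (1 - K * (r - s)) \<le> M * \<delta> * 1"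
      using r_bnd[OF that] M\<delta> by (intro mult_left_mono) auto
    moreover have "M * \<delta> * (c * (r - s)) \<le> M * \<delta> * 1"
      using r_bnd[OF that] M\<delta> by (intro mult_left_mono) auto
    moreover note r_bnd[OF that] M\<delta>
    ultimately show ?thesis
      by (cases "i \<in> S"; cases "i = q") (simp_all add: BS Bq Bn)
  qed
  have B0: "0 \<le> B i r" if "r \<in> {s..<s + h}" for i r
    using MB[OF that, of i] M\<delta> by simp
  have "v q (s + h) \<le> B q (s + h)"
  proof (rule subsolution_le_affine[OF sub _ _ s _ B_def])
    show "v i s \<le> p i" for i using init by (simp add: p_def)
    show "r \<in> {s..<s + h} \<Longrightarrow> 0 \<le> B i r" for i r by (rule B0)
    fix i :: 'f and r and \<alpha> :: "'f \<Rightarrow> real" and \<kappa> :: real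
    assume r: "r \<in> {s..<s + h}" and \<alpha>: "\<And>j. alo \<le> \<alpha> j \<and> \<alpha> j \<le> ahi" and \<kappa>: "0 \<le> \<kappa>"
      and \<kappa>b: "LNbr (sg r) i \<noteq> {} \<Longrightarrow> blo \<le> \<kappa>"
    have \<alpha>0: "0 \<le> \<alpha> j" for j using \<alpha>[of j] a by linarith
    have \<kappa>B: "0 \<le> \<kappa> * B i r" using \<kappa> B0[OF r] by simp
    have sum: "(\<Sum>j\<in>Nbr (sg r) i. \<alpha> j * (B j r - B i r)) \<le> K * (M - B i r)"
      unfolding K(1) using MB[OF r] a \<alpha>0 \<alpha> by (intro sum_weights_le) auto
    show "(\<Sum>j\<in>Nbr (sg r) i. \<alpha> j * (B j r - B i r)) - \<kappa> * B i r \<le> d i"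
    proof (cases "i = q")
      case False
      have "K * (M - B i r) \<le> d i"
      proof (cases "i \<in> S")
        case True
        then show ?thesis using mult_left_mono[OF conjunct2[OF MB[OF r, of i]] K0]
          by (simp add: d_def mult_ac)
      qed (use False in \<open>simp add: Bn d_def\<close>)
      then show ?thesis using sum \<kappa>B by linarith
    next
      case True
      have dq: "d i = - (M * \<delta> * c)" using True q by (simp add: d_def)
      \<comment> \<open>Upward pull on \<open>q\<close>: the others lie at most at \<open>M\<close>,
        and \<open>q\<close> has dropped by \<open>M * \<delta> * c * (r - s)\<close> so far. This
        costs at most \<open>M * \<delta> * c / 2\<close>, so a downward pull of three times that
        amount leaves the slope \<open>- M * \<delta> * c\<close>; hence the divisor 3 in
        \<open>c\<close>.\<close>
      have e: "K * (M - B q r) \<le> M * \<delta> * (c / 2)"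
      proof -
        have "K * (M - B q r) = M * \<delta> * (c * (K * (r - s)))" by (simp add: Bq)
        also have "\<dots> \<le> M * \<delta> * (c / 2)"
          using r_bnd[OF r] M\<delta> by (intro mult_left_mono) auto
        finally show ?thesis .
      qed
      have c3: "3 * c \<le> alo" "3 * c \<le> blo" using c by auto
      show ?thesis
      proof (cases "LNbr (sg r) i = {}")
        case False
        \<comment> \<open>Leader case: the barrier at \<open>q\<close> is still at least
          \<open>M / 2\<close>, so damping contributes at least \<open>blo * M / 2\<close>.\<close>
        have "M * \<delta> * c * (3 / 2) \<le> M * \<delta> * (blo / 2)"
          using mult_left_mono[OF c3(2) M\<delta>(1)] by (simp add: algebra_simps)
        also have "\<dots> \<le> M * (blo / 2)" using M\<delta> c3 c by (intro mult_right_mono) auto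
        also have "\<dots> \<le> blo * B q r"
        proof -
          have "M * \<delta> * (c * (r - s)) \<le> M * (1 / 2)"
            using r_bnd[OF r] M\<delta> M by (intro mult_mono) auto
          then have "M / 2 \<le> B q r" by (simp add: Bq)
          moreover have "0 \<le> blo" using c3 c(2) by linarith
          ultimately show ?thesis using mult_left_mono[of "M / 2" "B q r" blo] by (simp add: mult_ac)
        qed
        also have "\<dots> \<le> \<kappa> * B i r"
          using \<kappa>b[OF False] B0[OF r] True by (simp add: mult_right_mono)
        finally show ?thesis using sum e dq True by (simp add: field_simps)
      next
        case empty: True
        then obtain j0 where j0: "j0 \<in> Nbr (sg r) i" "j0 \<in> S" using arc[OF r] True by auto
        \<comment> \<open>Neighbour case: all neighbours are raised to \<open>M\<close> except
          \<open>j0\<close>, which stays below \<open>M\<close> by at least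
          \<open>M * \<delta> / 2\<close>.\<close>
        have "(\<Sum>j\<in>Nbr (sg r) i. \<alpha> j * (B j r - B i r))
            \<le> (\<Sum>j\<in>Nbr (sg r) i. \<alpha> j * (M - B i r) - (if j = j0 then \<alpha> j * (M - B j r) else 0))"
        proof (rule sum_mono)
          fix j
          have "\<alpha> j * B j r \<le> \<alpha> j * M" using \<alpha>0 MB[OF r, of j] by (intro mult_left_mono) auto
          then show "\<alpha> j * (B j r - B i r) \<le> \<alpha> j * (M - B i r) - (if j = j0 then \<alpha> j * (M - B j r) else 0)"
            by (auto simp: algebra_simps)
        qed
        also have "\<dots> = (\<Sum>j\<in>Nbr (sg r) i. \<alpha> j * (M - B i r)) - \<alpha> j0 * (M - B j0 r)"
          using j0 by (simp add: sum_subtractf)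
        also have "\<dots> \<le> K * (M - B i r) - alo * (M * \<delta> / 2)"
        proof (rule diff_mono)
          show "(\<Sum>j\<in>Nbr (sg r) i. \<alpha> j * (M - B i r)) \<le> K * (M - B i r)"
            unfolding K(1) using MB[OF r] a \<alpha>0 \<alpha> by (intro sum_weights_le) auto
          have "M * \<delta> * (1 / 2) \<le> M * \<delta> * (1 - K * (r - s))"
            using r_bnd[OF r] M\<delta> by (intro mult_left_mono) auto
          then have "M * \<delta> / 2 \<le> M - B j0 r" by (simp add: BS[OF j0(2)])
          then show "alo * (M * \<delta> / 2) \<le> \<alpha> j0 * (M - B j0 r)"
            using \<alpha>[of j0] M\<delta> a by (intro mult_mono) auto
        qed
        also have "\<dots> \<le> M * \<delta> * (c / 2) - (3 * c) * (M * \<delta> / 2)"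
          using e True c3 M\<delta> by (intro diff_mono mult_right_mono) auto
        also have "\<dots> = d i" by (simp add: dq field_simps)
        finally show ?thesis using \<kappa>B by linarith
      qed
    qed
  qed (use a h in auto)
  then show ?thesis by (simp add: Bq algebra_simps)
qed

section \<open>Crossing arcs\<close>

text \<open>Otherwise the leaders together with \<open>S\<close> would be closed under successors,
  and no path from a leader could reach a follower outside \<open>S\<close>.\<close>

lemma crossing_arc:
  assumes "L_connected G" "S \<noteq> UNIV"
  obtains q where "q \<notin> S" "Nbr G q \<inter> S \<noteq> {} \<or> LNbr G q \<noteq> {}"
proof (rule ccontr)
  assume "\<not> thesis"
  then have *: "Nbr G q \<inter> S = {}" "LNbr G q = {}" if "q \<notin> S" for q
    using \<open>\<And>q. q \<notin> S \<Longrightarrow> Nbr G q \<inter> S \<noteq> {} \<or> LNbr G q \<noteq> {} \<Longrightarrow> thesis\<close> that by blast+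
  obtain i where i: "i \<notin> S" using assms(2) by blast
  obtain j where j: "(Inr j, Inl i) \<in> G\<^sup>+" using assms(1) by (auto simp: L_connected_def)
  have "x \<in> range Inr \<union> Inl ` S" if "(Inr j, x) \<in> G\<^sup>+" for x
    using that
  proof induction
    case (base y)
    show ?case
    proof (cases y)
      case (Inl k)
      then have "LNbr G k \<noteq> {}" using base by (auto simp: LNbr_def)
      then show ?thesis using * Inl by blast
    qed simp
  next
    case (step y z)
    show ?case
    proof (cases z)
      case (Inl k)
      then have "Nbr G k \<inter> S \<noteq> {} \<or> LNbr G k \<noteq> {}"
        using step by (auto simp: LNbr_def Nbr_def)
      then show ?thesis using * Inl by blast
    qed simp
  qed
  with j i show False by blast
qed

text \<open>Lets the dwell time be shortened until the affine barriers apply on a whole dwell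
  interval.\<close>

lemma dwell_signal_antimono: "dwell_signal P \<tau> sg \<Longrightarrow> 0 < h \<Longrightarrow> h \<le> \<tau> \<Longrightarrow> dwell_signal P h sg"
  unfolding dwell_signal_def by (meson order_trans)

text \<open>An arc seen at time \<open>s\<close> may vanish right away, but the first crossing arc after the next
  switching instant survives for a full dwell time. Bidirectionality makes "no follower arc
  leaves \<open>S\<close>" and "no follower arc enters \<open>S\<close>" the same.\<close>
lemma persistent_crossing_arc:
  assumes sig: "dwell_signal P h sg" and jlc: "JLC sg" and bidir: "follower_bidirectional sg"
    and S: "S \<noteq> UNIV" and s: "0 \<le> s"
  obtains s1 t1 q where "s \<le> s1" "s1 \<le> s + h" "s1 \<le> t1"
    "\<And>t i. t \<in> {s1..<t1} \<Longrightarrow> i \<in> S \<Longrightarrow> Nbr (sg t) i \<subseteq> S"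
    "q \<notin> S" "Nbr (sg t1) q \<inter> S \<noteq> {} \<or> LNbr (sg t1) q \<noteq> {}"
    "\<And>t. t \<in> {t1..<t1 + h} \<Longrightarrow> sg t = sg t1"
proof -
  from sig obtain D where h: "0 < h"
    and D: "D \<subseteq> {0<..}" and sep: "\<And>x y. x \<in> D \<Longrightarrow> y \<in> D \<Longrightarrow> x \<noteq> y \<Longrightarrow> h \<le> \<bar>x - y\<bar>"
    and const: "\<And>a b. 0 \<le> a \<Longrightarrow> a \<le> b \<Longrightarrow> {a<..b} \<inter> D = {} \<Longrightarrow> sg b = sg a"
    unfolding dwell_signal_def by blast
  have after: "sg r = sg t" if "t \<in> D" "r \<in> {t..<t + h}" for t r
  proof (rule const)
    show "{t<..r} \<inter> D = {}"
      using sep[OF \<open>t \<in> D\<close>] that(2) by force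
  qed (use that D in force)+
  \<comment> \<open>Either no switch occurs in \<open>(s, s + h]\<close>, or \<open>s1\<close> is
    one. In both cases the graph is frozen on \<open>[s1, s1 + h)\<close>, so an arc crossing at
    \<open>s1\<close> itself also persists.\<close>
  define s1 where "s1 = (if {s<..s + h} \<inter> D = {} then s else SOME x. x \<in> {s<..s + h} \<inter> D)"
  have s1: "s1 = s \<and> {s<..s + h} \<inter> D = {} \<or> s1 \<in> {s<..s + h} \<inter> D"
    unfolding s1_def by (auto intro: someI2)
  have s1s: "s \<le> s1" "s1 \<le> s + h" "0 \<le> s1" using s1 s h by auto
  have s1h: "sg r = sg s1" if "r \<in> {s1..<s1 + h}" for r
  proof (cases "s1 \<in> D")
    case True
    then show ?thesis using after that by blast
  next
    case False
    then have "s1 = s" "{s<..s + h} \<inter> D = {}" using s1 by auto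
    then show ?thesis using that s by (intro const) force+
  qed
  define cross where "cross t \<longleftrightarrow> (\<exists>q. q \<notin> S \<and> (Nbr (sg t) q \<inter> S \<noteq> {} \<or> LNbr (sg t) q \<noteq> {}))" for t
  define A where "A = {t. s1 \<le> t \<and> cross t}"
  have "L_connected (joint_graph sg {s1..})" using jlc s1s by (auto simp: JLC_def)
  then obtain q where "q \<notin> S" "Nbr (joint_graph sg {s1..}) q \<inter> S \<noteq> {} \<or> LNbr (joint_graph sg {s1..}) q \<noteq> {}"
    using S crossing_arc by blast
  then have A_ne: "A \<noteq> {}"
    by (fastforce simp: A_def cross_def Nbr_def LNbr_def joint_graph_def)
  have bdd: "bdd_below A" by (auto simp: A_def)
  define t1 where "t1 = Inf A"
  have t1A: "t1 \<le> t" if "t \<in> A" for t unfolding t1_def using bdd that by (rule cInf_lower[rotated])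
  have st1: "s1 \<le> t1" unfolding t1_def by (rule cInf_greatest[OF A_ne]) (auto simp: A_def)
  \<comment> \<open>Switching instants are isolated, so the graph keeps its value at
    \<open>t1\<close> for a short time. Elements of \<open>A\<close> close to \<open>t1\<close> then
    show that the infimum is attained.\<close>
  have "\<exists>e>0. {t1<..<t1 + e} \<inter> D = {}"
  proof (cases "{t1<..<t1 + h} \<inter> D = {}")
    case False
    then obtain x where x: "x \<in> D" "t1 < x" "x < t1 + h" by auto
    have "{t1<..<t1 + (x - t1)} \<inter> D = {}" using sep[OF x(1)] x by force
    then show ?thesis using x by (intro exI[of _ "x - t1"]) auto
  qed (use h in blast)
  then obtain e where e: "0 < e" "{t1<..<t1 + e} \<inter> D = {}" by blast
  obtain t where t: "t \<in> A" "t < t1 + e"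
    using cInf_lessD[OF A_ne, of "t1 + e"] e unfolding t1_def by auto
  have "sg t = sg t1" using t e t1A[OF t(1)] s1s st1 by (intro const) force+
  then have ct1: "cross t1" using t by (simp add: A_def cross_def)
  then obtain q where q: "q \<notin> S" "Nbr (sg t1) q \<inter> S \<noteq> {} \<or> LNbr (sg t1) q \<noteq> {}"
    unfolding cross_def by blast
  have pers: "sg t = sg t1" if "t \<in> {t1..<t1 + h}" for t
  proof (cases "t1 = s1 \<or> t1 \<in> D")
    case True
    then show ?thesis using after s1h that by metis
  next
    case False
    then have lt: "s1 < t1" and nD: "t1 \<notin> D" using st1 by auto
    \<comment> \<open>If \<open>t1\<close> were neither \<open>s1\<close> nor a switch, the graph
      would be constant just before \<open>t1\<close> as well, which would give an earlier element
      of \<open>A\<close>.\<close>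
    have "\<exists>e>0. {t1 - e<..t1} \<inter> D = {}"
    proof (cases "{t1 - h<..t1} \<inter> D = {}")
      case False
      then obtain x where x: "x \<in> D" "t1 - h < x" "x < t1"
        using nD by (metis disjoint_iff greaterThanAtMost_iff order_le_less)
      have "{t1 - (t1 - x)<..t1} \<inter> D = {}" using sep[OF x(1)] x by force
      then show ?thesis using x by (intro exI[of _ "t1 - x"]) auto
    qed (use h in blast)
    then obtain e where e: "0 < e" "{t1 - e<..t1} \<inter> D = {}" by blast
    define r where "r = max s1 (t1 - e)"
    have "sg t1 = sg r" using e lt s1s by (intro const) (auto simp: r_def)
    then have "r \<in> A" using ct1 by (simp add: A_def cross_def r_def)
    then have "t1 \<le> r" by (rule t1A)
    then show ?thesis using lt e by (simp add: r_def)
  qed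
  have iso: "Nbr (sg t) i \<subseteq> S" if "t \<in> {s1..<t1}" "i \<in> S" for t i
  proof
    fix j assume "j \<in> Nbr (sg t) i"
    then have "i \<in> Nbr (sg t) j"
      using bidir that s1s by (auto simp: follower_bidirectional_def Nbr_def)
    then have "t \<in> A" if "j \<notin> S"
      using \<open>i \<in> S\<close> \<open>t \<in> {s1..<t1}\<close> that by (auto simp: A_def cross_def)
    then show "j \<in> S" using t1A \<open>t \<in> {s1..<t1}\<close> by force
  qed
  show thesis
    by (rule that[OF s1s(1,2) st1 iso q pers])
qed

section \<open>Uniform contraction\<close>

lemma gain_rate_bound:
  assumes "0 < alo" "alo \<le> ahi" "real CARD('f::finite) * ahi * h \<le> 1 / 2" "c = min alo blo / 3" "0 \<le> h"
  shows "c * h \<le> 1 / 2"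
proof -
  have "1 * alo \<le> real CARD('f) * ahi"
    using assms by (intro mult_mono) (auto simp: Suc_leI)
  moreover have "3 * c \<le> alo" using assms by simp
  ultimately have "c \<le> real CARD('f) * ahi" using assms(1) by linarith
  then have "c * h \<le> real CARD('f) * ahi * h" using assms by (intro mult_right_mono)
  then show ?thesis using assms by linarith
qed

text \<open>Three phases: on \<open>[s, s1]\<close> the margin of \<open>S\<close> is at most
  halved, on \<open>[s1, t1]\<close> it is kept because \<open>S\<close> is isolated, and on
  \<open>[t1, t1 + h]\<close> it is at most halved again while \<open>q\<close> gains one. Both
  \<open>s'\<close> and \<open>q\<close> are fixed before \<open>v\<close>, \<open>M\<close> and
  \<open>\<delta>\<close>, so they serve all subsolutions at once.\<close>

lemma subsolution_recruit:
  fixes sg :: "real \<Rightarrow> ('f::finite + 'l::finite) rel"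
  assumes sig: "dwell_signal P h sg" and jlc: "JLC sg" and bidir: "follower_bidirectional sg"
    and a: "0 < alo" "alo \<le> ahi" and K: "real CARD('f) * ahi * h \<le> 1 / 2"
    and c: "c = min alo blo / 3" "0 < c"
    and S: "S \<noteq> UNIV" and s: "0 \<le> s"
  obtains s' q where "q \<notin> S" "s + h \<le> s'"
    "\<And>v M \<delta> i. subsolution sg alo ahi blo v \<Longrightarrow> 0 \<le> M \<Longrightarrow> 0 \<le> \<delta> \<Longrightarrow> \<delta> \<le> 1 \<Longrightarrow> (\<And>i. v i s \<le> M) \<Longrightarrow>
      (\<And>i. i \<in> S \<Longrightarrow> v i s \<le> M * (1 - \<delta>)) \<Longrightarrow> i \<in> insert q S \<Longrightarrow> v i s' \<le> M * (1 - \<delta> * (c * h / 2))"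
proof -
  obtain s1 t1 q where s1: "s \<le> s1" "s1 \<le> s + h" "s1 \<le> t1"
    and iso: "\<And>t i. t \<in> {s1..<t1} \<Longrightarrow> i \<in> S \<Longrightarrow> Nbr (sg t) i \<subseteq> S"
    and q: "q \<notin> S" "Nbr (sg t1) q \<inter> S \<noteq> {} \<or> LNbr (sg t1) q \<noteq> {}"
    and pers: "\<And>t. t \<in> {t1..<t1 + h} \<Longrightarrow> sg t = sg t1"
    using persistent_crossing_arc[OF sig jlc bidir S s] by metis
  have h: "0 < h" using sig by (simp add: dwell_signal_def)
  have aK: "alo \<le> real CARD('f) * ahi"
    using a mult_mono[of 1 "real CARD('f)" alo ahi] by (simp add: Suc_leI)
  show thesis
  proof (rule that[of q "t1 + h"])
    show "s + h \<le> t1 + h" using s1 by simp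
    fix v :: "'f \<Rightarrow> real \<Rightarrow> real" and M \<delta> :: real and i :: 'f
    assume sub: "subsolution sg alo ahi blo v" and M: "0 \<le> M" and \<delta>: "0 \<le> \<delta>" "\<delta> \<le> 1"
      and init: "\<And>i. v i s \<le> M" "\<And>i. i \<in> S \<Longrightarrow> v i s \<le> M * (1 - \<delta>)" and i: "i \<in> insert q S"
    have a0: "0 \<le> alo" using a by simp
    have vM: "v i t \<le> M" if "s \<le> t" for i t
      by (rule subsolution_le_const[OF sub a0 a(2) s that M init(1)])
    have s1': "v i s1 \<le> M * (1 - \<delta> / 2)" if "i \<in> S" for i
    proof (rule subsolution_leak[OF sub a0 a(2) refl _ s s1(1) M \<delta> init that])
      show "real CARD('f) * ahi * (s1 - s) \<le> 1 / 2"
        using K s1 a aK mult_left_mono[of "s1 - s" h "real CARD('f) * ahi"] by linarith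
    qed
    have t1': "v i t1 \<le> M * (1 - \<delta> / 2)" if "i \<in> S" for i
      by (rule subsolution_isolated[OF sub a0 a(2) _ s1(3) M _ _ iso vM s1' that])
        (use s s1 \<delta> in auto)
    have st1: "0 \<le> t1" "s \<le> t1" using s s1 by auto
    have arc: "Nbr (sg r) q \<inter> S \<noteq> {} \<or> LNbr (sg r) q \<noteq> {}" if "r \<in> {t1..<t1 + h}" for r
      using q(2) unfolding pers[OF that] .
    have q': "v q (t1 + h) \<le> M * (1 - \<delta> / 2 * c * h)"
      by (rule subsolution_gain[OF sub a refl K _ c st1(1) M _ _ arc q(1) vM t1'])
        (use h \<delta> st1 in auto)
    have S': "v i (t1 + h) \<le> M * (1 - \<delta> / 2 / 2)" if "i \<in> S" for i
      by (rule subsolution_leak[OF sub a0 a(2) refl _ st1(1) _ M _ _ vM t1' that])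
        (use h \<delta> K st1 in auto)
    \<comment> \<open>Two halvings leave \<open>S\<close> the margin factor
      \<open>\<delta> / 4\<close>, while \<open>q\<close> has \<open>\<delta> * c * h / 2\<close>;
      the latter is the smaller and serves for both.\<close>
    have "c * h \<le> 1 / 2" using gain_rate_bound[OF a K c(1)] h by simp
    then have "\<delta> * (c * h / 2) \<le> \<delta> * (1 / 4)" using \<delta> by (intro mult_left_mono) auto
    then have "M * (1 - \<delta> / 2 / 2) \<le> M * (1 - \<delta> * (c * h / 2))"
      using M by (intro mult_left_mono) auto
    then show "v i (t1 + h) \<le> M * (1 - \<delta> * (c * h / 2))"
      using i q' S'[of i] by (auto simp: mult_ac)
  qed (rule q)
qed

text \<open>Recruiting one follower at a time multiplies the margin by \<open>c * h / 2\<close>, so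
  after \<open>CARD('f)\<close> rounds everybody has the margin factor
  \<open>(c * h / 2) ^ CARD('f)\<close>. The end \<open>s'\<close> does not depend on
  \<open>v\<close>, but its distance from \<open>s\<close> is not bounded.\<close>

lemma subsolution_window:
  fixes sg :: "real \<Rightarrow> ('f::finite + 'l::finite) rel"
  assumes sig: "dwell_signal P h sg" and jlc: "JLC sg" and bidir: "follower_bidirectional sg"
    and a: "0 < alo" "alo \<le> ahi" and K: "real CARD('f) * ahi * h \<le> 1 / 2"
    and c: "c = min alo blo / 3" "0 < c"
    and s: "0 \<le> s"
  obtains s' where "s + h \<le> s'"
    "\<And>v M i. subsolution sg alo ahi blo v \<Longrightarrow> 0 \<le> M \<Longrightarrow> (\<And>i. v i s \<le> M) \<Longrightarrow>
      v i s' \<le> M * (1 - (c * h / 2) ^ CARD('f))"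
proof -
  have h: "0 < h" using sig by (simp add: dwell_signal_def)
  have ch: "0 \<le> c * h / 2" "c * h / 2 \<le> 1"
    using gain_rate_bound[OF a K c(1)] c(2) h by simp_all
  have "\<exists>s' S. card S = k \<and> s + real k * h \<le> s' \<and>
      (\<forall>v M. subsolution sg alo ahi blo v \<longrightarrow> 0 \<le> M \<longrightarrow> (\<forall>i. v i s \<le> M) \<longrightarrow>
        (\<forall>i\<in>S. v i s' \<le> M * (1 - (c * h / 2) ^ k)))" if "k \<le> CARD('f)" for k
    using that
  proof (induction k)
    case 0
    \<comment> \<open>The induction starts with the full margin factor 1 on the empty set.\<close>
    show ?case by (intro exI[of _ s] exI[of _ "{}"]) auto
  next
    case (Suc k)
    then obtain t S where S: "card S = k" "s + real k * h \<le> t"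
      and IH: "\<And>v M i. subsolution sg alo ahi blo v \<Longrightarrow> 0 \<le> M \<Longrightarrow> (\<And>i. v i s \<le> M) \<Longrightarrow> i \<in> S \<Longrightarrow>
        v i t \<le> M * (1 - (c * h / 2) ^ k)"
      by (metis Suc_leD)
    have "S \<noteq> UNIV" using S Suc.prems by auto
    have st: "s \<le> t" using S(2) h mult_nonneg_nonneg[of "real k" h] by linarith
    then have t0: "0 \<le> t" using s by simp
    from subsolution_recruit[OF sig jlc bidir a K c \<open>S \<noteq> UNIV\<close> t0]
    obtain t' q where q: "q \<notin> S" "t + h \<le> t'"
      and step: "\<And>v M \<delta> i. subsolution sg alo ahi blo v \<Longrightarrow> 0 \<le> M \<Longrightarrow> 0 \<le> \<delta> \<Longrightarrow> \<delta> \<le> 1 \<Longrightarrow> (\<And>i. v i t \<le> M) \<Longrightarrow>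
      (\<And>i. i \<in> S \<Longrightarrow> v i t \<le> M * (1 - \<delta>)) \<Longrightarrow> i \<in> insert q S \<Longrightarrow> v i t' \<le> M * (1 - \<delta> * (c * h / 2))"
      by metis
    have "v i t' \<le> M * (1 - (c * h / 2) ^ Suc k)"
      if v: "subsolution sg alo ahi blo v" "0 \<le> M" "\<forall>i. v i s \<le> M" and i: "i \<in> insert q S" for v M i
    proof -
      have "v i t' \<le> M * (1 - (c * h / 2) ^ k * (c * h / 2))"
      proof (rule step[OF v(1,2) _ _ _ _ i])
        show "v j t \<le> M" for j
          by (rule subsolution_le_const[OF v(1) _ a(2) s st v(2)]) (use a v(3) in auto)
        show "v j t \<le> M * (1 - (c * h / 2) ^ k)" if "j \<in> S" for j
          using IH[OF v(1,2)] v(3) that by blast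
      qed (use ch in \<open>auto intro: power_le_one\<close>)
      then show ?thesis by (simp add: mult_ac)
    qed
    moreover have "card (insert q S) = Suc k" using S q by simp
    moreover have "s + real (Suc k) * h \<le> t'" using S q by (simp add: algebra_simps)
    ultimately show ?case by blast
  qed
  from this[of "CARD('f)"] obtain s' and S :: "'f set" where S: "card S = CARD('f)"
    and s': "s + real CARD('f) * h \<le> s'"
    and dec: "\<And>v M i. subsolution sg alo ahi blo v \<Longrightarrow> 0 \<le> M \<Longrightarrow> (\<forall>i. v i s \<le> M) \<Longrightarrow> i \<in> S \<Longrightarrow>
        v i s' \<le> M * (1 - (c * h / 2) ^ CARD('f))"
    by blast
  have "S = UNIV" using S by (simp add: card_eq_UNIV_imp_eq_UNIV)
  moreover have "s + h \<le> s'"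
  proof -
    have "1 * h \<le> real CARD('f) * h" using h by (intro mult_right_mono) (simp_all add: Suc_leI)
    then show ?thesis using s' by linarith
  qed
  ultimately show thesis using dec by (intro that[of s']) auto
qed

text \<open>Contraction windows are concatenated at times \<open>T n\<close>, and
  \<open>\<eta> t\<close> is \<open>\<theta>\<close> to the number of windows completed by time
  \<open>t\<close>. As each window lasts at least \<open>h\<close>, the times \<open>T n\<close>
  tend to infinity and cover the half-line.\<close>

lemma subsolution_decay:
  fixes sg :: "real \<Rightarrow> ('f::finite + 'l::finite) rel"
  assumes sig: "dwell_signal P tauD sg" and jlc: "JLC sg" and bidir: "follower_bidirectional sg"
    and a: "0 < alo" "alo \<le> ahi" and blo: "0 < blo"
  obtains \<eta> :: "real \<Rightarrow> real" where "\<And>t. 0 < \<eta> t" "antimono \<eta>" "(\<eta> \<longlongrightarrow> 0) at_top"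
    "\<And>v M t i. subsolution sg alo ahi blo v \<Longrightarrow> 0 \<le> M \<Longrightarrow> (\<And>i. v i 0 \<le> M) \<Longrightarrow> 0 \<le> t \<Longrightarrow> v i t \<le> M * \<eta> t"
proof -
  define K where "K = real CARD('f) * ahi"
  define h where "h = min tauD (1 / (2 * K))"
  define c where "c = min alo blo / 3"
  define \<theta> where "\<theta> = 1 - (c * h / 2) ^ CARD('f)"
  have aK: "alo \<le> K"
    using a mult_mono[of 1 "real CARD('f)" alo ahi] by (simp add: K_def Suc_leI)
  then have K0: "0 < K" using a by simp
  have h: "0 < h" using K0 sig by (simp add: h_def dwell_signal_def)
  have Kh: "K * h \<le> 1 / 2"
    using K0 mult_left_mono[of h "1 / (2 * K)" K] by (simp add: h_def)
  have c: "0 < c" using a blo by (simp add: c_def)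
  have sig': "dwell_signal P h sg" using sig by (rule dwell_signal_antimono) (use h in \<open>auto simp: h_def\<close>)
  have "c * h \<le> 1 / 2"
    using gain_rate_bound[OF a Kh[unfolded K_def] c_def] h by simp
  then have "c * h / 2 < 1" "0 < c * h / 2" using c h by simp_all
  \<comment> \<open>Positivity of \<open>\<theta>\<close> later makes \<open>r * \<eta> t\<close>
    strictly increasing in \<open>r\<close>, as class K demands.\<close>
  then have \<theta>: "0 < \<theta>" "\<theta> < 1" by (auto simp: \<theta>_def power_less_one_iff)
  \<comment> \<open>The contraction clause quantifies over all subsolutions inside the choice, so a
    single sequence \<open>T\<close> works for every trajectory and every direction.\<close>
  have "\<exists>T. \<forall>n. (0 \<le> T n \<and> (n = 0 \<longrightarrow> T n = 0)) \<and> (T n + h \<le> T (Suc n) \<and>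
    (\<forall>v M. subsolution sg alo ahi blo v \<longrightarrow> 0 \<le> M \<longrightarrow> (\<forall>i. v i (T n) \<le> M) \<longrightarrow> (\<forall>i. v i (T (Suc n)) \<le> M * \<theta>)))"
  proof (rule dependent_nat_choice[where P = "\<lambda>n t. 0 \<le> t \<and> (n = 0 \<longrightarrow> t = 0)" and
        Q = "\<lambda>n t t'. t + h \<le> t' \<and> (\<forall>v M. subsolution sg alo ahi blo v \<longrightarrow> 0 \<le> M \<longrightarrow>
          (\<forall>i. v i t \<le> M) \<longrightarrow> (\<forall>i. v i t' \<le> M * \<theta>))"])
    fix s :: real and n :: nat assume "0 \<le> s \<and> (n = 0 \<longrightarrow> s = 0)"
    then have s: "0 \<le> s" by simp
    from subsolution_window[OF sig' jlc bidir a Kh[unfolded K_def] c_def c s]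
    obtain s' where s': "s + h \<le> s'"
      "\<And>v M i. subsolution sg alo ahi blo v \<Longrightarrow> 0 \<le> M \<Longrightarrow> (\<And>i. v i s \<le> M) \<Longrightarrow> v i s' \<le> M * \<theta>"
      unfolding \<theta>_def by metis
    then have "0 \<le> s'" using s h by linarith
    moreover have "\<forall>v M. subsolution sg alo ahi blo v \<longrightarrow> 0 \<le> M \<longrightarrow> (\<forall>i. v i s \<le> M) \<longrightarrow> (\<forall>i. v i s' \<le> M * \<theta>)"
      by (intro allI impI) (rule s'(2), simp_all)
    ultimately show "\<exists>s'. (0 \<le> s' \<and> (Suc n = 0 \<longrightarrow> s' = 0)) \<and> s + h \<le> s' \<and>
      (\<forall>v M. subsolution sg alo ahi blo v \<longrightarrow> 0 \<le> M \<longrightarrow> (\<forall>i. v i s \<le> M) \<longrightarrow> (\<forall>i. v i s' \<le> M * \<theta>))"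
      using s'(1) by (intro exI[of _ s'] conjI impI) simp_all
  qed (rule exI[of _ 0], simp)
  then obtain T where T_all: "\<forall>n. (0 \<le> T n \<and> (n = 0 \<longrightarrow> T n = 0)) \<and> (T n + h \<le> T (Suc n) \<and>
    (\<forall>v M. subsolution sg alo ahi blo v \<longrightarrow> 0 \<le> M \<longrightarrow> (\<forall>i. v i (T n) \<le> M) \<longrightarrow> (\<forall>i. v i (T (Suc n)) \<le> M * \<theta>)))"
    ..
  then have T: "T n + h \<le> T (Suc n)" "T 0 = 0" for n by simp_all
  have dec: "v i (T (Suc n)) \<le> M * \<theta>"
    if "subsolution sg alo ahi blo v" "0 \<le> M" "\<And>i. v i (T n) \<le> M" for v M n i
    using T_all[THEN spec[of _ n]] that by simp
  have Th: "real n * h \<le> T n" for n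
  proof (induction n)
    case (Suc n)
    then show ?case using T(1)[of n] by (simp add: algebra_simps)
  qed (simp add: T)
  have "incseq T" using T(1) h by (intro incseq_SucI) (meson add_increasing2 order_trans less_imp_le order_refl)
  \<comment> \<open>For nonnegative \<open>t\<close> this is the index with
    \<open>T (N t) \<le> t < T (Suc (N t))\<close>; for negative \<open>t\<close> it is 0, which
    keeps \<open>\<eta>\<close> antimonotone on the whole line.\<close>
  define N where "N t = (LEAST n. t < T (Suc n))" for t
  have N: "t < T (Suc (N t))" for t
  proof -
    obtain n where "t / h < real n" using reals_Archimedean2 by blast
    then have "t < real n * h" using h by (simp add: divide_simps)
    also have "\<dots> \<le> T (Suc n)" using Th[of n] T(1)[of n] h by linarith
    finally show ?thesis unfolding N_def by (rule LeastI)
  qed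
  have N_mono: "N s \<le> N t" if "s \<le> t" for s t
    using N[of t] that unfolding N_def[of s] by (intro Least_le) auto
  have N_ge: "n \<le> N t" if "T n \<le> t" for n t
  proof (rule ccontr)
    assume "\<not> n \<le> N t"
    then have "T (Suc (N t)) \<le> T n" using \<open>incseq T\<close> by (simp add: incseqD)
    then show False using N[of t] that by simp
  qed
  have N_le: "T (N t) \<le> t" if "0 \<le> t" for t
  proof (cases "N t")
    case (Suc n)
    then have "n < (LEAST n. t < T (Suc n))" by (simp add: N_def)
    from not_less_Least[OF this] show ?thesis unfolding Suc by simp
  qed (use that T in simp)
  have lim: "filterlim N at_top at_top"
    unfolding filterlim_at_top using N_ge eventually_ge_at_top by (metis (mono_tags, lifting) eventually_mono)
  show thesis
  proof (rule that[of "\<lambda>t. \<theta> ^ N t"])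
    show "antimono (\<lambda>t. \<theta> ^ N t)"
      using \<theta> N_mono by (intro antimonoI power_decreasing) auto
    show "((\<lambda>t. \<theta> ^ N t) \<longlongrightarrow> 0) at_top"
      using filterlim_compose[OF LIMSEQ_power_zero lim, of \<theta>] \<theta> by simp
    fix v :: "'f \<Rightarrow> real \<Rightarrow> real" and M t :: real and i :: 'f
    assume v: "subsolution sg alo ahi blo v" and M: "0 \<le> M" and init: "\<And>i. v i 0 \<le> M" and t: "0 \<le> t"
    have vT: "v i (T n) \<le> M * \<theta> ^ n" for n i
    proof (induction n arbitrary: i)
      case (Suc n)
      then show ?case using dec[OF v, of "M * \<theta> ^ n" n i] M \<theta> by (simp add: mult_ac)
    qed (use init T in simp)
    show "v i t \<le> M * \<theta> ^ N t"
    proof (rule subsolution_le_const[OF v _ a(2) _ N_le[OF t] _ vT])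
      show "0 \<le> T (N t)" using Th[of "N t"] h by (auto intro: order_trans[rotated])
    qed (use a M \<theta> in auto)
  qed (use \<theta> in simp)
qed

section \<open>Joint connectivity implies stability\<close>

lemma compact_leader_hull: "compact (leader_hull yv)"
  unfolding leader_hull_def by (intro finite_imp_compact_convex_hull) simp

lemma inner_leader_hull_le:
  assumes "y \<in> leader_hull yv"
  shows "p \<bullet> y \<le> Max (range (\<lambda>j. p \<bullet> yv $ j))"
proof -
  have "leader_hull yv \<subseteq> {y. p \<bullet> y \<le> Max (range (\<lambda>j. p \<bullet> yv $ j))}"
    unfolding leader_hull_def
    by (intro hull_minimal) (auto simp: convex_halfspace_le)
  then show ?thesis using assms by auto
qed

lemma infdist_leader_hull_attained:
  obtains q where "q \<in> leader_hull yv" "infdist v (leader_hull yv) = dist v q"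
proof -
  have "leader_hull yv \<noteq> {}" by (simp add: leader_hull_def)
  then show thesis
    using infdist_attains_inf[OF compact_imp_closed[OF compact_leader_hull]] that by metis
qed

text \<open>Easy half of the duality between distance and support function, by Cauchy-Schwarz at a
  nearest point. It bounds the scalar initial data by the initial distance.\<close>

lemma support_le_infdist_leader_hull:
  assumes "norm p \<le> 1"
  shows "p \<bullet> v - Max (range (\<lambda>j. p \<bullet> yv $ j)) \<le> infdist v (leader_hull yv)"
proof -
  obtain q where q: "q \<in> leader_hull yv" "infdist v (leader_hull yv) = dist v q"
    by (rule infdist_leader_hull_attained)
  have "p \<bullet> (v - q) \<le> norm p * norm (v - q)" by (rule norm_cauchy_schwarz)
  also have "\<dots> \<le> dist v q" using assms by (simp add: dist_norm mult_left_le_one_le)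
  finally show ?thesis using inner_leader_hull_le[OF q(1), of p] q by (simp add: inner_diff_right)
qed

text \<open>Hard half of the duality: the direction from the nearest point \<open>q\<close> to
  \<open>v\<close> attains the distance. It turns scalar bounds, uniform in \<open>p\<close>, back
  into a distance bound at time \<open>t\<close>.\<close>

lemma infdist_leader_hull_le:
  assumes "\<And>p. norm p \<le> 1 \<Longrightarrow> p \<bullet> v - Max (range (\<lambda>j. p \<bullet> yv $ j)) \<le> B"
  shows "infdist v (leader_hull yv) \<le> B"
proof -
  obtain q where q: "q \<in> leader_hull yv" "infdist v (leader_hull yv) = dist v q"
    by (rule infdist_leader_hull_attained)
  \<comment> \<open>If \<open>v\<close> lies in the hull then \<open>v = q\<close>, and
    \<open>sgn 0 = 0\<close> covers this case too.\<close>
  define p where "p = sgn (v - q)"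
  have "Max (range (\<lambda>j. p \<bullet> yv $ j)) \<le> p \<bullet> q"
  proof (rule Max.boundedI)
    fix m assume "m \<in> range (\<lambda>j. p \<bullet> yv $ j)"
    then obtain j where j: "m = p \<bullet> yv $ j" by blast
    \<comment> \<open>Variational inequality of the projection onto a closed convex set.\<close>
    have "(v - q) \<bullet> (yv $ j - q) \<le> 0"
    proof (rule any_closest_point_dot[where S = "leader_hull yv"])
      show "yv $ j \<in> leader_hull yv" by (simp add: leader_hull_def hull_inc)
      show "\<forall>z\<in>leader_hull yv. dist v q \<le> dist v z" using q by (metis infdist_le)
    qed (auto simp: q compact_imp_closed compact_leader_hull, simp add: leader_hull_def)
    then have "p \<bullet> (yv $ j - q) \<le> 0"
      by (simp add: p_def sgn_div_norm mult_le_0_iff divide_le_0_iff)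
    then show "m \<le> p \<bullet> q" by (simp add: j inner_diff_right)
  qed auto
  moreover have "p \<bullet> v - p \<bullet> q = dist v q"
  proof -
    have "p \<bullet> v - p \<bullet> q = (v - q) \<bullet> (v - q) / norm (v - q)"
      by (simp add: p_def sgn_div_norm inner_diff_right divide_inverse algebra_simps)
    then show ?thesis by (simp add: dot_square_norm power2_eq_square dist_norm)
  qed
  moreover have "norm p \<le> 1" by (simp add: p_def norm_sgn)
  ultimately show ?thesis using assms[of p] q by linarith
qed

lemma inner_vec_lambda_sum:
  fixes p :: "real^'d::finite"
  shows "p \<bullet> (\<Sum>j\<in>N. c j *\<^sub>R (X j - Y)) = (\<Sum>j\<in>N. c j * (p \<bullet> X j - p \<bullet> Y))"
  by (simp add: inner_sum_right inner_diff_right)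

text \<open>Testing against a fixed vector \<open>p\<close> avoids differentiating the distance to a moving hull:
  the coordinates \<open>p \<bullet> x i\<close>, compared with the initial support value of the leaders plus the
  accumulated input, form a subsolution.\<close>
lemma subsolution_of_solution:
  fixes sg :: "real \<Rightarrow> ('f::finite + 'l::finite) rel"
    and a :: "'f \<Rightarrow> 'f \<Rightarrow> (real^'d::finite)^'f \<Rightarrow> (real^'d)^'l \<Rightarrow> real \<Rightarrow> real"
    and b :: "'f \<Rightarrow> 'l \<Rightarrow> (real^'d)^'f \<Rightarrow> (real^'d)^'l \<Rightarrow> real \<Rightarrow> real"
  assumes a_bnd: "\<And>i j x y t. alo \<le> a i j x y t \<and> a i j x y t \<le> ahi"
    and b_bnd: "\<And>i j x y t. blo \<le> b i j x y t" and blo: "0 < blo" and alo: "0 \<le> alo"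
    and sol: "is_solution sg a b u w x y"
    and zint: "\<And>t. 0 \<le> t \<Longrightarrow> (\<lambda>s. norm (input_signal u w y s)) integrable_on {0..t}"
    and W_def: "\<And>t. W t = integral {0..t} (\<lambda>s. norm (input_signal u w y s))"
    and p: "norm p \<le> 1"
  shows "subsolution sg alo ahi blo
      (\<lambda>i t. p \<bullet> x t $ i - Max (range (\<lambda>j. p \<bullet> y 0 $ j)) - W t)"
    and "\<And>t j. 0 \<le> t \<Longrightarrow> \<bar>p \<bullet> y t $ j - p \<bullet> y 0 $ j\<bar> \<le> W t"
proof -
  define z where "z s = norm (input_signal u w y s)" for s
  define c where "c = Max (range (\<lambda>j. p \<bullet> y 0 $ j))"
  define V where "V i t = p \<bullet> x t $ i - c - W t" for i t
  have p_le: "\<bar>p \<bullet> q\<bar> \<le> norm q" for q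
    using Cauchy_Schwarz_ineq2[of p q] mult_right_mono[OF p norm_ge_zero[of q]] by simp
  have u_le: "\<bar>p \<bullet> leader_rhs u y s $ j\<bar> \<le> z s" for s j
    using p_le[of "leader_rhs u y s $ j"] Finite_Cartesian_Product.norm_nth_le[of "leader_rhs u y s" j]
      norm_fst_le[of "leader_rhs u y s" "\<chi> i. w i s"]
    by (simp add: z_def input_signal_def)
  have w_le: "\<bar>p \<bullet> w i s\<bar> \<le> z s" for s i
    using p_le[of "w i s"] Finite_Cartesian_Product.norm_nth_le[of "\<chi> i. w i s" i]
      norm_snd_le[of "\<chi> i. w i s" "leader_rhs u y s"]
    by (simp add: z_def input_signal_def)
  have W: "(z has_integral W t) {0..t}" if "0 \<le> t" for t
    using zint[OF that] unfolding W_def z_def[symmetric] by (rule integrable_integral)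
  have coord: "((\<lambda>s. p \<bullet> f s $ i) has_integral p \<bullet> I $ i) S" if "(f has_integral I) S"
    for f :: "real \<Rightarrow> (real^'d)^'n::finite" and I i S
  proof -
    have "bounded_linear (\<lambda>q. p \<bullet> (q $ i :: real^'d))"
      using bounded_linear_compose[OF bounded_linear_inner_right bounded_linear_vec_nth] .
    from has_integral_linear[OF that this] show ?thesis by (simp add: o_def)
  qed
  have lead: "(leader_rhs u y has_integral y t - y 0) {0..t}"
    and foll: "(follower_rhs sg a b w x y has_integral x t - x 0) {0..t}" if "0 \<le> t" for t
    using sol that unfolding is_solution_def has_integral_iff
    by (auto dest: set_lebesgue_integral_eq_integral(1))
  have yW: "\<bar>p \<bullet> y t $ j - p \<bullet> y 0 $ j\<bar> \<le> W t" if "0 \<le> t" for t j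
  proof -
    have l: "((\<lambda>s. p \<bullet> leader_rhs u y s $ j) has_integral p \<bullet> y t $ j - p \<bullet> y 0 $ j) {0..t}"
      using coord[OF lead[OF that], of j] by (simp add: inner_diff_right)
    have "p \<bullet> y t $ j - p \<bullet> y 0 $ j \<le> W t"
      by (rule has_integral_le[OF l W[OF that]]) (use u_le abs_le_D1 in blast)
    moreover have "- (p \<bullet> y t $ j - p \<bullet> y 0 $ j) \<le> W t"
      by (rule has_integral_le[OF has_integral_neg[OF l] W[OF that]]) (use u_le abs_le_D2 in blast)
    ultimately show ?thesis by linarith
  qed
  then show "\<And>t j. 0 \<le> t \<Longrightarrow> \<bar>p \<bullet> y t $ j - p \<bullet> y 0 $ j\<bar> \<le> W t" .
  have yc: "p \<bullet> y t $ j \<le> c + W t" if "0 \<le> t" for t j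
  proof -
    have "p \<bullet> y 0 $ j \<le> c" unfolding c_def by (rule Max_ge) auto
    then show ?thesis using yW[OF that, of j] by linarith
  qed
  \<comment> \<open>Subtracting \<open>W\<close> serves twice: its derivative \<open>z\<close>
    absorbs the disturbance \<open>p \<bullet> w i\<close>, and its value absorbs the drift of the
    leaders, so that \<open>p \<bullet> y r $ j - p \<bullet> x r $ i \<le> - V i r\<close>.\<close>
  define g where "g i s = p \<bullet> follower_rhs sg a b w x y s $ i - z s" for i s
  \<comment> \<open>The total leader weight is at least \<open>blo\<close> as soon as it has one
    summand; no upper bound is asked of it.\<close>
  define \<kappa> where "\<kappa> i s = (\<Sum>j\<in>LNbr (sg s) i. b i j (x s) (y s) s)" for i s
  have W0: "W 0 = 0" unfolding W_def by simp
  have b0: "0 \<le> b i j q r t" for i j q r t using b_bnd[of i j q r t] blo by linarith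
  have "subsolution sg alo ahi blo V"
    unfolding subsolution_def
  proof (rule exI[of _ g], rule exI[of _ "\<lambda>i j s. a i j (x s) (y s) s"], rule exI[of _ \<kappa>],
      intro conjI allI impI)
    fix i s
    show "alo \<le> a i j (x s) (y s) s" "a i j (x s) (y s) s \<le> ahi" for j using a_bnd by auto
    show "0 \<le> \<kappa> i s" unfolding \<kappa>_def by (intro sum_nonneg b0)
    show "blo \<le> \<kappa> i s" if ne: "LNbr (sg s) i \<noteq> {}"
    proof -
      obtain j where j: "j \<in> LNbr (sg s) i" using ne by blast
      then have "b i j (x s) (y s) s \<le> \<kappa> i s"
        unfolding \<kappa>_def by (intro member_le_sum b0) auto
      then show ?thesis using b_bnd order_trans by blast
    qed
  next
    fix i r assume r: "(0::real) \<le> r"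
    have "((\<lambda>s. p \<bullet> follower_rhs sg a b w x y s $ i - z s) has_integral p \<bullet> (x r - x 0) $ i - W r) {0..r}"
      by (intro has_integral_diff coord foll W r)
    then show "(g i has_integral V i r - V i 0) {0..r}"
      by (simp add: g_def[abs_def] V_def W0 inner_diff_right algebra_simps)
    assume V0: "0 \<le> V i r"
    have "g i r = (\<Sum>j\<in>Nbr (sg r) i. a i j (x r) (y r) r * (p \<bullet> x r $ j - p \<bullet> x r $ i))
        + (\<Sum>j\<in>LNbr (sg r) i. b i j (x r) (y r) r * (p \<bullet> y r $ j - p \<bullet> x r $ i)) + (p \<bullet> w i r - z r)"
      by (simp add: g_def follower_rhs_def inner_add_right inner_vec_lambda_sum)
    also have "\<dots> \<le> (\<Sum>j\<in>Nbr (sg r) i. a i j (x r) (y r) r * (max 0 (V j r) - V i r))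
        + (\<Sum>j\<in>LNbr (sg r) i. b i j (x r) (y r) r * (- V i r)) + 0"
    proof (intro add_mono sum_mono mult_left_mono)
      show "p \<bullet> x r $ j - p \<bullet> x r $ i \<le> max 0 (V j r) - V i r" for j
        by (auto simp: V_def)
      show "p \<bullet> y r $ j - p \<bullet> x r $ i \<le> - V i r" for j
        using yc[OF r, of j] by (simp add: V_def)
      show "p \<bullet> w i r - z r \<le> 0" using w_le[of i r] by linarith
      show "0 \<le> a i j (x r) (y r) r" for j using a_bnd order_trans[OF alo] by blast
    qed (rule b0)
    also have "\<dots> = (\<Sum>j\<in>Nbr (sg r) i. a i j (x r) (y r) r * (max 0 (V j r) - V i r)) - \<kappa> i r * V i r"
      by (simp add: \<kappa>_def sum_distrib_right sum_negf)
    finally show "g i r \<le> (\<Sum>j\<in>Nbr (sg r) i. a i j (x r) (y r) r * (max 0 (V j r) - V i r)) - \<kappa> i r * V i r" .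
  qed
  then show "subsolution sg alo ahi blo
      (\<lambda>i t. p \<bullet> x t $ i - Max (range (\<lambda>j. p \<bullet> y 0 $ j)) - W t)"
    by (simp add: V_def[abs_def] c_def)
qed

lemma input_signal_integrable:
  fixes y :: "real \<Rightarrow> (real^'d::finite)^'l::finite" and w :: "'f::finite \<Rightarrow> real \<Rightarrow> real^'d"
  assumes "admissible u w" "leader_rhs u y absolutely_integrable_on {0..t}"
  shows "(\<lambda>s. norm (input_signal u w y s)) integrable_on {0..t}"
proof -
  have bl: "bounded_linear (\<lambda>q. (q, 0))" "bounded_linear (\<lambda>q. (0, q))"
    for q :: "'z::real_normed_vector"
    by (intro bounded_linear_Pair bounded_linear_ident bounded_linear_zero)+
  have "continuous_on {0..t} (\<lambda>s. \<chi> i. w i s)"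
    using assms(1) by (intro continuous_on_vec_lambda) (auto simp: admissible_def intro: continuous_on_subset)
  then have "(\<lambda>s. \<chi> i. w i s) absolutely_integrable_on {0..t}"
    by (rule absolutely_integrable_continuous_real)
  then have "(\<lambda>s. (0, \<chi> i. w i s) :: ((real^'d)^'l) \<times> ((real^'d)^'f)) absolutely_integrable_on {0..t}"
    using absolutely_integrable_linear[OF _ bl(2)] by (fastforce simp: o_def)
  moreover have "(\<lambda>s. (leader_rhs u y s, 0) :: ((real^'d)^'l) \<times> ((real^'d)^'f)) absolutely_integrable_on {0..t}"
    using absolutely_integrable_linear[OF assms(2) bl(1)] by (simp add: o_def)
  ultimately have "(\<lambda>s. (leader_rhs u y s, 0) + (0, \<chi> i. w i s)) absolutely_integrable_on {0..t}"
    by (rule set_integral_add(1)[rotated])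
  then have "input_signal u w y absolutely_integrable_on {0..t}"
    by (simp add: input_signal_def[abs_def])
  then show ?thesis unfolding absolutely_integrable_on_def by simp
qed

lemma JLC_imp_SiISS:
  fixes sg :: "real \<Rightarrow> ('f::finite + 'l::finite) rel"
    and a :: "'f \<Rightarrow> 'f \<Rightarrow> (real^'d::finite)^'f \<Rightarrow> (real^'d)^'l \<Rightarrow> real \<Rightarrow> real"
    and b :: "'f \<Rightarrow> 'l \<Rightarrow> (real^'d)^'f \<Rightarrow> (real^'d)^'l \<Rightarrow> real \<Rightarrow> real"
  assumes sig: "dwell_signal P tauD sg" and bidir: "follower_bidirectional sg"
    and a: "0 < alo" "alo \<le> ahi" "\<And>i j x y t. alo \<le> a i j x y t \<and> a i j x y t \<le> ahi"
    and b: "0 < blo" "\<And>i j x y t. blo \<le> b i j x y t"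
    and jlc: "JLC sg"
  shows "SiISS sg a b"
proof -
  obtain \<eta> :: "real \<Rightarrow> real" where \<eta>: "\<And>t. 0 < \<eta> t" "antimono \<eta>" "(\<eta> \<longlongrightarrow> 0) at_top"
    and decay: "\<And>v M t i. subsolution sg alo ahi blo v \<Longrightarrow> 0 \<le> M \<Longrightarrow> (\<And>i. v i 0 \<le> M) \<Longrightarrow> 0 \<le> t \<Longrightarrow>
      v i t \<le> M * \<eta> t"
    using subsolution_decay[OF sig jlc bidir a(1,2) b(1)] by metis
  have KL: "class_KL (\<lambda>r t. r * \<eta> t)"
    unfolding class_KL_def class_K_def
  proof (intro conjI allI impI)
    show "strict_mono_on {0..} (\<lambda>r. r * \<eta> t)" for t
      using \<eta>(1)[of t] by (intro strict_mono_onI) simp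
    show "((\<lambda>t. r * \<eta> t) \<longlongrightarrow> 0) at_top" for r
      using tendsto_mult_left[OF \<eta>(3), of r] by simp
    show "antimono_on {0..} (\<lambda>t. r * \<eta> t)" if "0 \<le> r" for r
      using \<eta>(2) that by (auto intro!: monotone_onI mult_left_mono dest: antimonoD)
  qed (auto intro!: continuous_intros)
  \<comment> \<open>The gain is 2 because \<open>W\<close> is paid once as the offset in the
    subsolution and once for the motion of the leader hull.\<close>
  have K: "class_K (\<lambda>r. 2 * r)"
    unfolding class_K_def by (auto intro!: continuous_intros strict_mono_onI)
  have "ennreal (dist_hull (x t) (y t)) \<le> ennreal (dist_hull (x 0) (y 0) * \<eta> t) +
      (\<integral>\<^sup>+ s\<in>{0..t}. ennreal (2 * norm (input_signal u w y s)) \<partial>lborel)"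
    if adm: "admissible u w" and sol: "is_solution sg a b u w x y" and t: "0 \<le> t" for u w x y t
  proof -
    define z where "z s = norm (input_signal u w y s)" for s
    define W where "W t = integral {0..t} z" for t
    have zint: "z integrable_on {0..t}" if "0 \<le> t" for t
      unfolding z_def by (rule input_signal_integrable[OF adm])
        (use sol that in \<open>simp add: is_solution_def\<close>)
    define D0 where "D0 = dist_hull (x 0) (y 0)"
    have infdist_D0: "infdist (x 0 $ i) (leader_hull (y 0)) \<le> D0" for i
      unfolding D0_def dist_hull_def by (rule Max_ge) auto
    then have D0: "0 \<le> D0" using infdist_nonneg order_trans by blast
    have W0: "0 \<le> W t" unfolding W_def by (intro integral_nonneg zint t) (simp add: z_def)
    have "infdist (x t $ i) (leader_hull (y t)) \<le> D0 * \<eta> t + 2 * W t" for i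
    proof (rule infdist_leader_hull_le)
      fix p :: "real^'d" assume p: "norm p \<le> 1"
      define c where "c = Max (range (\<lambda>j. p \<bullet> y 0 $ j))"
      note ss = subsolution_of_solution[where a = a and b = b and u = u and x = x and W = W,
          OF a(3) b(2,1) less_imp_le[OF a(1)] sol _ _ p, folded z_def c_def, OF zint W_def]
      have "p \<bullet> x t $ i - c - W t \<le> D0 * \<eta> t"
      proof (rule decay[OF ss(1) D0 _ t])
        show "p \<bullet> x 0 $ i - c - W 0 \<le> D0" for i
          using support_le_infdist_leader_hull[OF p, of "x 0 $ i" "y 0"] infdist_D0[of i]
          by (simp add: c_def W_def)
      qed (use a in auto)
      \<comment> \<open>A leader attaining the initial support value has moved by at most
        \<open>W t\<close> in direction \<open>p\<close>.\<close>
      moreover have "c - W t \<le> Max (range (\<lambda>j. p \<bullet> y t $ j))"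
      proof -
        have "c \<in> range (\<lambda>j. p \<bullet> y 0 $ j)" unfolding c_def by (rule Max_in) auto
        then obtain j where "c = p \<bullet> y 0 $ j" by blast
        then have "c - W t \<le> p \<bullet> y t $ j" using ss(2)[OF _ t, of j] by simp
        also have "\<dots> \<le> Max (range (\<lambda>j. p \<bullet> y t $ j))" by (rule Max_ge) auto
        finally show ?thesis .
      qed
      ultimately show "p \<bullet> x t $ i - Max (range (\<lambda>j. p \<bullet> y t $ j)) \<le> D0 * \<eta> t + 2 * W t"
        by linarith
    qed
    then have "dist_hull (x t) (y t) \<le> D0 * \<eta> t + 2 * W t"
      unfolding dist_hull_def by (intro Max.boundedI) auto
    then have "ennreal (dist_hull (x t) (y t)) \<le> ennreal (D0 * \<eta> t) + ennreal (2 * W t)"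
      using D0 W0 less_imp_le[OF \<eta>(1)[of t]] by (simp add: ennreal_leI flip: ennreal_plus)
    also have "ennreal (2 * W t) = (\<integral>\<^sup>+ s\<in>{0..t}. ennreal (2 * z s) \<partial>lborel)"
    proof (rule nn_integral_has_integral_lebesgue'[symmetric])
      show "((\<lambda>s. 2 * z s) has_integral 2 * W t) {0..t}"
        unfolding W_def by (intro has_integral_mult_right integrable_integral zint t)
    qed (simp add: z_def)
    finally show ?thesis by (simp add: D0_def z_def)
  qed
  then show ?thesis
    unfolding SiISS_def using KL K by blast
qed

section \<open>Existence of solutions\<close>

text \<open>The delayed equation \<open>X' t = F t (X (t - h))\<close> is solved by steps: every
  iteration of the integral operator settles a further time interval of length \<open>h\<close>, so
  finitely many reach \<open>b\<close>.\<close>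

lemma tonelli_approximation:
  fixes F :: "real \<Rightarrow> 'a::euclidean_space \<Rightarrow> 'a"
  assumes ab: "a \<le> b" and h: "0 < h"
    and int: "\<And>c. continuous_on UNIV c \<Longrightarrow> (\<lambda>s. F s (c s)) integrable_on {a..b}"
  obtains X where "continuous_on UNIV X" "\<And>t. t \<le> a \<Longrightarrow> X t = x0"
    "\<And>t. t \<in> {a..b} \<Longrightarrow> ((\<lambda>s. F s (X (s - h))) has_integral X t - x0) {a..t}"
proof -
  \<comment> \<open>Clamping the upper limit to \<open>[a, b]\<close> makes every iterate continuous
    on the whole line, as \<open>int\<close> requires, and equal to \<open>x0\<close> to the left of
    \<open>a\<close>.\<close>
  define \<Phi> where "\<Phi> X t = x0 + integral {a..max a (min b t)} (\<lambda>s. F s (X (s - h)))" for X t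
  define X where "X k = (\<Phi> ^^ k) (\<lambda>_. x0)" for k
  have X_Suc: "X (Suc k) t = x0 + integral {a..max a (min b t)} (\<lambda>s. F s (X k (s - h)))" for k t
    by (simp add: X_def \<Phi>_def)
  have X0: "X 0 t = x0" for t by (simp add: X_def)
  have cont: "continuous_on UNIV (X k)" for k
  proof (induction k)
    case 0
    then show ?case by (simp add: X_def)
  next
    case (Suc k)
    have "continuous_on UNIV (\<lambda>s. X k (s - h))"
      by (rule continuous_on_compose2[OF Suc]) (auto intro!: continuous_intros)
    from indefinite_integral_continuous_1[OF int[OF this]]
    have "continuous_on UNIV (\<lambda>t. integral {a..max a (min b t)} (\<lambda>s. F s (X k (s - h))))"
      by (rule continuous_on_compose2) (use ab in \<open>auto intro!: continuous_intros\<close>)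
    then show ?case unfolding X_Suc[abs_def] by (intro continuous_intros)
  qed
  have stable: "X (Suc k) t = X k t" if "t \<le> a + real k * h" for k t
    using that
  proof (induction k arbitrary: t)
    case 0
    then have "max a (min b t) = a" by simp
    then show ?case by (simp add: X_Suc X0)
  next
    case (Suc k)
    have "integral {a..max a (min b t)} (\<lambda>s. F s (X (Suc k) (s - h)))
        = integral {a..max a (min b t)} (\<lambda>s. F s (X k (s - h)))"
    proof (rule integral_cong)
      fix s assume s: "s \<in> {a..max a (min b t)}"
      have "0 \<le> real k * h" using h by simp
      moreover have "real (Suc k) * h = real k * h + h" by (simp add: algebra_simps)
      moreover have "s \<le> a \<or> s \<le> t" using s by auto
      ultimately have "s - h \<le> a + real k * h" using Suc.prems h by linarith
      then show "F s (X (Suc k) (s - h)) = F s (X k (s - h))" using Suc.IH by simp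
    qed
    then show ?case by (simp add: X_Suc[of "Suc k"] X_Suc[of k])
  qed
  obtain k where "(b - a) / h < real k" using reals_Archimedean2 by blast
  then have k: "b \<le> a + real k * h" using h by (simp add: divide_simps algebra_simps)
  show thesis
  proof (rule that[of "X k"])
    show "continuous_on UNIV (X k)" by (rule cont)
    show "X k t = x0" if "t \<le> a" for t
    proof -
      have "max a (min b t) = a" using that by simp
      then show ?thesis using stable[of t k] that k ab by (simp add: X_Suc)
    qed
    fix t assume t: "t \<in> {a..b}"
    have "continuous_on UNIV (\<lambda>s. X k (s - h))"
      by (rule continuous_on_compose2[OF cont]) (auto intro!: continuous_intros)
    from int[OF this] have "(\<lambda>s. F s (X k (s - h))) integrable_on {a..t}"
      by (rule integrable_on_subinterval) (use t in auto)
    then have "((\<lambda>s. F s (X k (s - h))) has_integral X (Suc k) t - x0) {a..t}"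
      using t by (simp add: X_Suc integrable_integral)
    then show "((\<lambda>s. F s (X k (s - h))) has_integral X k t - x0) {a..t}"
      using stable[of t k] t k by simp
  qed
qed

text \<open>The delayed approximations with delay tending to 0 are bounded and share the Lipschitz
  constant \<open>M\<close>. Arzela-Ascoli gives a uniformly convergent subsequence, and dominated
  convergence with the constant bound \<open>M\<close> passes to the limit under the
  integral.\<close>

lemma peano_caratheodory:
  fixes F :: "real \<Rightarrow> 'a::euclidean_space \<Rightarrow> 'a"
  assumes ab: "a \<le> b"
    and bnd: "\<And>s q. s \<in> {a..b} \<Longrightarrow> norm (F s q) \<le> M"
    and cont: "\<And>s. s \<in> {a..b} \<Longrightarrow> continuous_on UNIV (F s)"
    and int: "\<And>c. continuous_on UNIV c \<Longrightarrow> (\<lambda>s. F s (c s)) integrable_on {a..b}"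
  obtains \<xi> where "\<xi> a = x0"
    "\<And>t. t \<in> {a..b} \<Longrightarrow> ((\<lambda>s. F s (\<xi> s)) has_integral \<xi> t - \<xi> a) {a..t}"
proof -
  define h where "h n = 1 / real (Suc n)" for n
  have h: "0 < h n" for n by (simp add: h_def)
  have M: "0 \<le> M" using order_trans[OF norm_ge_zero bnd[of a 0]] ab by simp
  have "\<exists>X. continuous_on UNIV X \<and> (\<forall>t\<le>a. X t = x0) \<and>
      (\<forall>t\<in>{a..b}. ((\<lambda>s. F s (X (s - h n))) has_integral X t - x0) {a..t})" for n
    by (rule tonelli_approximation[where F = F and ?x0.0 = x0, OF ab h[of n] int]) auto
  then obtain X where "\<forall>n. continuous_on UNIV (X n) \<and> (\<forall>t\<le>a. X n t = x0) \<and>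
      (\<forall>t\<in>{a..b}. ((\<lambda>s. F s (X n (s - h n))) has_integral X n t - x0) {a..t})"
    using choice[of "\<lambda>n X. continuous_on UNIV X \<and> (\<forall>t\<le>a. X t = x0) \<and>
      (\<forall>t\<in>{a..b}. ((\<lambda>s. F s (X (s - h n))) has_integral X t - x0) {a..t})"] by blast
  then have Xa: "\<And>n t. t \<le> a \<Longrightarrow> X n t = x0"
    and X: "\<And>n t. t \<in> {a..b} \<Longrightarrow> ((\<lambda>s. F s (X n (s - h n))) has_integral X n t - x0) {a..t}"
    by simp_all
  have lip: "norm (X n t - X n s) \<le> M * (t - s)" if "a \<le> s" "s \<le> t" "t \<le> b" for n s t
  proof -
    have "((\<lambda>s. F s (X n (s - h n))) has_integral (X n t - x0) - (X n s - x0)) {s..t}"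
      by (rule has_integral_Icc_diff[OF X X]) (use that in auto)
    then have "norm ((X n t - x0) - (X n s - x0)) \<le> M * measure lborel {s..t}"
      by (rule has_integral_bound_real[OF M finite.emptyI]) (use bnd that in auto)
    then show ?thesis using that by simp
  qed
  have lip': "norm (X n t - X n s) \<le> M * \<bar>t - s\<bar>" if "s \<in> {a..b}" "t \<in> {a..b}" for n s t
    using lip[of s t n] lip[of t s n] that by (cases "s \<le> t") (auto simp: norm_minus_commute)
  \<comment> \<open>The delay costs at most \<open>M * h n\<close>, also near \<open>a\<close>,
    since \<open>X n\<close> is constant to the left of \<open>a\<close>.\<close>
  have shift: "norm (X n (t - h n) - X n t) \<le> M * h n" if t: "t \<in> {a..b}" for n t
  proof (cases "a \<le> t - h n")
    case True
    then show ?thesis using lip[of "t - h n" t n] h[of n] t by (simp add: norm_minus_commute)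
  next
    case False
    then have "norm (X n (t - h n) - X n t) = norm (X n t - X n a)"
      using Xa by (simp add: norm_minus_commute)
    also have "\<dots> \<le> M * (t - a)" using lip t by simp
    also have "\<dots> \<le> M * h n" using False M by (intro mult_left_mono) auto
    finally show ?thesis .
  qed
  obtain \<xi> k where k: "strict_mono (k :: nat \<Rightarrow> nat)"
    and unif: "\<And>e. 0 < e \<Longrightarrow> \<exists>N. \<forall>n t. n \<ge> N \<and> t \<in> {a..b} \<longrightarrow> norm (X (k n) t - \<xi> t) < e"
  proof (rule Arzela_Ascoli[of "{a..b}" X "norm x0 + M * (b - a)"])
    fix n t assume t: "t \<in> {a..b}"
    have "norm (X n t) \<le> norm (X n a) + norm (X n t - X n a)" by (rule norm_triangle_sub)
    also have "\<dots> \<le> norm x0 + M * (t - a)" using lip[of a t n] t Xa[of a n] by simp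
    also have "\<dots> \<le> norm x0 + M * (b - a)" using t M by (intro add_left_mono mult_left_mono) auto
    finally show "norm (X n t) \<le> norm x0 + M * (b - a)" .
  next
    fix s e :: real assume s: "s \<in> {a..b}" and e: "0 < e"
    show "\<exists>d>0. \<forall>n t. t \<in> {a..b} \<and> norm (s - t) < d \<longrightarrow> norm (X n s - X n t) < e"
    proof (intro exI[of _ "e / (M + 1)"] conjI allI impI)
      show "0 < e / (M + 1)" using e M by simp
      fix n t assume t: "t \<in> {a..b} \<and> norm (s - t) < e / (M + 1)"
      have "norm (X n s - X n t) \<le> M * \<bar>s - t\<bar>" using lip'[of t s n] s t by simp
      also have "\<dots> \<le> (M + 1) * \<bar>s - t\<bar>" by (intro mult_right_mono) auto
      also have "\<dots> < e" using t M by (simp add: divide_simps mult.commute)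
      finally show "norm (X n s - X n t) < e" .
    qed
  qed (blast | simp)+
  have lim: "(\<lambda>n. X (k n) t) \<longlonglongrightarrow> \<xi> t" if "t \<in> {a..b}" for t
    using unif that unfolding LIMSEQ_def dist_norm by meson
  have h0: "(\<lambda>n. h (k n)) \<longlonglongrightarrow> 0"
    using LIMSEQ_subseq_LIMSEQ[OF LIMSEQ_inverse_real_of_nat k]
    by (simp add: h_def o_def inverse_eq_divide)
  have lim': "(\<lambda>n. X (k n) (t - h (k n))) \<longlonglongrightarrow> \<xi> t" if t: "t \<in> {a..b}" for t
  proof -
    have "(\<lambda>n. M * h (k n)) \<longlonglongrightarrow> 0" using tendsto_mult_left[OF h0, of M] by simp
    then have "(\<lambda>n. X (k n) (t - h (k n)) - X (k n) t) \<longlonglongrightarrow> 0"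
      by (rule Lim_null_comparison[rotated]) (use shift[OF t] in simp)
    from tendsto_add[OF this lim[OF t]] show ?thesis by simp
  qed
  have sol: "((\<lambda>s. F s (\<xi> s)) has_integral \<xi> t - x0) {a..t}" if t: "t \<in> {a..b}" for t
  proof (rule has_integral_dominated_convergence[OF X[OF t], where h = "\<lambda>_. M"])
    show "\<forall>s\<in>{a..t}. norm (F s (X (k n) (s - h (k n)))) \<le> M" for n
      using bnd t by auto
    show "\<forall>s\<in>{a..t}. (\<lambda>n. F s (X (k n) (s - h (k n)))) \<longlonglongrightarrow> F s (\<xi> s)"
      using t by (auto intro!: continuous_on_tendsto_compose[OF cont] lim')
    show "(\<lambda>n. X (k n) t - x0) \<longlonglongrightarrow> \<xi> t - x0"
      by (intro tendsto_intros lim t)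
  qed (rule integrable_const_ivl)
  have "\<xi> a = x0"
    using integral_unique[OF sol[of a]] ab by simp
  then show thesis using that sol by blast
qed

text \<open>Local solutions on \<open>[n, n + 1]\<close> are glued by dependent choice, so the bound
  on \<open>F\<close> may grow with \<open>n\<close>.\<close>

lemma peano_caratheodory_global:
  fixes F :: "real \<Rightarrow> 'a::euclidean_space \<Rightarrow> 'a"
  assumes bnd: "\<And>n s q. s \<in> {real n..real (Suc n)} \<Longrightarrow> norm (F s q) \<le> M n"
    and cont: "\<And>s. 0 \<le> s \<Longrightarrow> continuous_on UNIV (F s)"
    and int: "\<And>c r t. continuous_on UNIV c \<Longrightarrow> 0 \<le> r \<Longrightarrow> (\<lambda>s. F s (c s)) integrable_on {r..t}"
  obtains \<xi> where "\<xi> 0 = x0"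
    "\<And>t. 0 \<le> t \<Longrightarrow> ((\<lambda>s. F s (\<xi> s)) has_integral \<xi> t - x0) {0..t}"
proof -
  have piece: "\<exists>\<phi>. \<phi> (real n) = q \<and> (\<forall>t\<in>{real n..real (Suc n)}.
      ((\<lambda>s. F s (\<phi> s)) has_integral \<phi> t - \<phi> (real n)) {real n..t})" for n q
  proof -
    obtain \<phi> where "\<phi> (real n) = q" "\<And>t. t \<in> {real n..real (Suc n)} \<Longrightarrow>
      ((\<lambda>s. F s (\<phi> s)) has_integral \<phi> t - \<phi> (real n)) {real n..t}"
      by (rule peano_caratheodory[of "real n" "real (Suc n)" F "M n" q])
        (use bnd cont int in auto)
    then show ?thesis by blast
  qed
  have "\<exists>\<phi>. \<forall>n. ((n = 0 \<longrightarrow> \<phi> n 0 = x0) \<and> (\<forall>t\<in>{real n..real (Suc n)}.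
      ((\<lambda>s. F s (\<phi> n s)) has_integral \<phi> n t - \<phi> n (real n)) {real n..t}))
      \<and> \<phi> (Suc n) (real (Suc n)) = \<phi> n (real (Suc n))"
  proof (rule dependent_nat_choice[where P = "\<lambda>n \<phi>. (n = 0 \<longrightarrow> \<phi> 0 = x0) \<and> (\<forall>t\<in>{real n..real (Suc n)}.
      ((\<lambda>s. F s (\<phi> s)) has_integral \<phi> t - \<phi> (real n)) {real n..t})" and
      Q = "\<lambda>n \<phi> \<phi>'. \<phi>' (real (Suc n)) = \<phi> (real (Suc n))"])
    show "\<exists>\<phi>. (0 = (0::nat) \<longrightarrow> \<phi> 0 = x0) \<and> (\<forall>t\<in>{real 0..real (Suc 0)}.
      ((\<lambda>s. F s (\<phi> s)) has_integral \<phi> t - \<phi> (real 0)) {real 0..t})"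
      using piece[of 0 x0] by auto
    show "\<exists>\<phi>'. ((Suc n = 0 \<longrightarrow> \<phi>' 0 = x0) \<and> (\<forall>t\<in>{real (Suc n)..real (Suc (Suc n))}.
      ((\<lambda>s. F s (\<phi>' s)) has_integral \<phi>' t - \<phi>' (real (Suc n))) {real (Suc n)..t}))
      \<and> \<phi>' (real (Suc n)) = \<phi> (real (Suc n))" for \<phi> n
      using piece[of "Suc n" "\<phi> (real (Suc n))"] by blast
  qed
  then obtain \<phi> where \<phi>0: "\<phi> 0 0 = x0" and \<phi>: "\<And>n t. t \<in> {real n..real (Suc n)} \<Longrightarrow>
      ((\<lambda>s. F s (\<phi> n s)) has_integral \<phi> n t - \<phi> n (real n)) {real n..t}"
    and match: "\<And>n. \<phi> (Suc n) (real (Suc n)) = \<phi> n (real (Suc n))"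
    by blast
  \<comment> \<open>At an integer the later piece is taken; it agrees with the earlier one by
    \<open>match\<close>.\<close>
  define \<xi> where "\<xi> t = \<phi> (nat \<lfloor>t\<rfloor>) t" for t
  have \<xi>: "\<xi> t = \<phi> n t" if "t \<in> {real n..real (Suc n)}" for n t
  proof (cases "t = real (Suc n)")
    case True
    have "nat \<lfloor>t\<rfloor> = Suc n" unfolding True by (metis floor_of_nat nat_int)
    then show ?thesis using match[of n] True by (simp add: \<xi>_def)
  next
    case False
    then have "\<lfloor>t\<rfloor> = int n" using that by (intro floor_unique) auto
    then show ?thesis by (simp add: \<xi>_def)
  qed
  have loc: "((\<lambda>s. F s (\<xi> s)) has_integral \<xi> t - \<xi> (real n)) {real n..t}"
    if t: "t \<in> {real n..real (Suc n)}" for n t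
  proof (rule has_integral_eq)
    show "((\<lambda>s. F s (\<phi> n s)) has_integral \<xi> t - \<xi> (real n)) {real n..t}"
      using \<phi>[OF t] \<xi>[OF t] \<xi>[of "real n" n] by simp
    show "F s (\<phi> n s) = F s (\<xi> s)" if "s \<in> {real n..t}" for s
      using \<xi>[of s n] that t by simp
  qed
  have \<xi>0: "\<xi> 0 = x0" using \<xi>[of 0 0] \<phi>0 by simp
  have int_n: "((\<lambda>s. F s (\<xi> s)) has_integral \<xi> (real n) - x0) {0..real n}" for n
  proof (induction n)
    case 0
    then show ?case using loc[of 0 0] \<xi>0 by simp
  next
    case (Suc n)
    have "((\<lambda>s. F s (\<xi> s)) has_integral (\<xi> (real n) - x0) + (\<xi> (real (Suc n)) - \<xi> (real n))) {0..real (Suc n)}"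
      by (rule has_integral_combine[OF _ _ Suc loc]) auto
    then show ?case by simp
  qed
  show thesis
  proof (rule that[of \<xi>, OF \<xi>0])
    fix t :: real assume t: "0 \<le> t"
    define n where "n = nat \<lfloor>t\<rfloor>"
    have n: "t \<in> {real n..real (Suc n)}"
    proof -
      have "real n = real_of_int \<lfloor>t\<rfloor>" using t by (simp add: n_def)
      moreover have "real (Suc n) = real n + 1" by simp
      ultimately have "real n \<le> t" "t \<le> real (Suc n)" by linarith+
      then show ?thesis by simp
    qed
    have "((\<lambda>s. F s (\<xi> s)) has_integral (\<xi> (real n) - x0) + (\<xi> t - \<xi> (real n))) {0..t}"
      by (rule has_integral_combine[OF _ _ int_n loc[OF n]]) (use n in auto)
    then show "((\<lambda>s. F s (\<xi> s)) has_integral \<xi> t - x0) {0..t}" by simp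
  qed
qed

text \<open>Away from 0 and the closed set of switching instants the signal is locally constant. A
  level set is therefore an open set together with a countable one.\<close>

lemma dwell_signal_level_borel:
  assumes "dwell_signal P tauD sg"
  shows "{s. 0 \<le> s \<and> sg s = G} \<in> sets borel"
proof -
  from assms obtain D where h: "0 < tauD"
    and D: "D \<subseteq> {0<..}" and sep: "\<And>x y. x \<in> D \<Longrightarrow> y \<in> D \<Longrightarrow> x \<noteq> y \<Longrightarrow> tauD \<le> \<bar>x - y\<bar>"
    and const: "\<And>a b. 0 \<le> a \<Longrightarrow> a \<le> b \<Longrightarrow> {a<..b} \<inter> D = {} \<Longrightarrow> sg b = sg a"
    unfolding dwell_signal_def by blast
  have cD: "closed D"
    by (rule discrete_imp_closed[OF h]) (use sep in \<open>force simp: dist_real_def\<close>)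
  \<comment> \<open>Two switches in the same cell of length \<open>tauD\<close> would be closer than
    the dwell time; so the switches inject into the integers.\<close>
  have "inj_on (\<lambda>x. \<lfloor>x / tauD\<rfloor>) D"
  proof (rule inj_onI, rule ccontr)
    fix x y assume xy: "x \<in> D" "y \<in> D" "\<lfloor>x / tauD\<rfloor> = \<lfloor>y / tauD\<rfloor>" "x \<noteq> y"
    then have "\<bar>x / tauD - y / tauD\<bar> < 1" by linarith
    then have "\<bar>x - y\<bar> < tauD" using h by (simp add: flip: diff_divide_distrib)
    then show False using sep[OF xy(1,2,4)] by simp
  qed
  then have "countable D" by (rule countable_image_inj_on[rotated]) simp
  define B where "B = {s. 0 < s \<and> s \<notin> D \<and> sg s = G}"
  have "open B"
    unfolding open_dist
  proof
    fix s assume "s \<in> B"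
    then have s: "0 < s" "s \<notin> D" "sg s = G" by (auto simp: B_def)
    have "open ({0<..} - D)" using cD by (intro open_Diff) auto
    then obtain e where e: "0 < e" "\<And>r. dist r s < e \<Longrightarrow> r \<in> {0<..} - D"
      using s unfolding open_dist by blast
    have "sg r = sg s" if r: "dist r s < e" for r
    proof -
      have *: "q \<notin> D" if "min r s \<le> q" "q \<le> max r s" for q
        using e(2)[of q] r that by (auto simp: dist_real_def min_def max_def split: if_splits)
      have r0: "0 < r" using e(2)[OF r] by simp
      show ?thesis
      proof (cases "r \<le> s")
        case True
        then show ?thesis using const[of r s] * r0 by fastforce
      next
        case False
        then show ?thesis using const[of s r] * s by fastforce
      qed
    qed
    then show "\<exists>e>0. \<forall>r. dist r s < e \<longrightarrow> r \<in> B"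
      using e s by (intro exI[of _ e]) (auto simp: B_def)
  qed
  moreover have eq: "{s. 0 \<le> s \<and> sg s = G} = B \<union> ({s. 0 \<le> s \<and> sg s = G} \<inter> insert 0 D)"
    using D by (auto simp: B_def)
  moreover have "countable ({s. 0 \<le> s \<and> sg s = G} \<inter> insert 0 D)"
    using \<open>countable D\<close> by (intro countable_Int2) simp
  then have "{s. 0 \<le> s \<and> sg s = G} \<inter> insert 0 D \<in> sets borel"
    by (rule sets.countable[rotated]) auto
  ultimately show ?thesis by (subst eq) (rule sets.Un[OF borel_open])
qed

text \<open>The switched function is a finite sum, over all digraphs on the finite vertex type, of
  continuous functions restricted to measurable level sets.\<close>

lemma switched_absolutely_integrable:
  fixes sg :: "real \<Rightarrow> ('f::finite + 'l::finite) rel"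
    and H :: "('f + 'l) rel \<Rightarrow> real \<Rightarrow> 'a::euclidean_space"
  assumes sig: "dwell_signal P tauD sg" and H: "\<And>G. continuous_on {r..t} (H G)" and r: "0 \<le> r"
  shows "(\<lambda>s. H (sg s) s) absolutely_integrable_on {r..t}"
proof -
  define A where "A G = {s. 0 \<le> s \<and> sg s = G}" for G
  have "(\<lambda>s. indicat_real (A G) s *\<^sub>R H G s) absolutely_integrable_on {r..t}" for G
  proof -
    have "H G absolutely_integrable_on {r..t}"
      by (rule absolutely_integrable_continuous_real[OF H])
    moreover have "{r..t} \<inter> A G \<in> sets lborel"
      using dwell_signal_level_borel[OF sig, of G] unfolding A_def by (simp add: sets.Int)
    then have "{r..t} \<inter> A G \<in> sets lebesgue" by (rule sets_completionI_sets)
    ultimately have "H G absolutely_integrable_on ({r..t} \<inter> A G)"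
      by (rule set_integrable_subset) auto
    then show ?thesis by (simp add: set_integrable_def indicator_inter_arith)
  qed
  then have "(\<lambda>s. \<Sum>G\<in>UNIV. indicat_real (A G) s *\<^sub>R H G s) absolutely_integrable_on {r..t}"
    by (intro absolutely_integrable_sum) auto
  moreover have "(\<Sum>G\<in>UNIV. indicat_real (A G) s *\<^sub>R H G s) = H (sg s) s" if "s \<in> {r..t}" for s
  proof -
    have "(\<Sum>G\<in>UNIV. indicat_real (A G) s *\<^sub>R H G s) = (\<Sum>G\<in>UNIV. if G = sg s then H G s else 0)"
      using that r by (intro sum.cong) (auto simp: A_def)
    then show ?thesis by simp
  qed
  ultimately show ?thesis by (subst (asm) set_integrable_cong[OF refl refl])
qed

section \<open>Stability implies joint connectivity\<close>

text \<open>If \<open>U\<close> only listens to itself and to leaders of total weight at most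
  \<open>C\<close>, its minimum decays no faster than \<open>exp (- C * t)\<close>. It is used first
  with all followers up to \<open>t0\<close>, then with \<open>C = 0\<close> on the unreachable
  set.\<close>

lemma decay_lower_bound:
  fixes \<xi> g :: "'f::finite \<Rightarrow> real \<Rightarrow> real"
  assumes ahi: "0 \<le> ahi" and C: "0 \<le> C" and c: "0 \<le> c" and st: "s \<le> t"
    and I: "\<And>i r. r \<in> {s..t} \<Longrightarrow> (g i has_integral \<xi> i r - \<xi> i s) {s..r}"
    and \<xi>0: "\<And>i r. r \<in> {s..t} \<Longrightarrow> 0 \<le> \<xi> i r"
    and init: "\<And>i. i \<in> U \<Longrightarrow> c \<le> \<xi> i s"
    and g: "\<And>i r. r \<in> {s..t} \<Longrightarrow> g i r = (\<Sum>j\<in>N i r. \<alpha> i j r * (\<xi> j r - \<xi> i r)) - \<kappa> i r * \<xi> i r"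
    and N: "\<And>i r. r \<in> {s..t} \<Longrightarrow> i \<in> U \<Longrightarrow> N i r \<subseteq> U"
    and \<alpha>: "\<And>i j r. 0 \<le> \<alpha> i j r \<and> \<alpha> i j r \<le> ahi"
    and \<kappa>: "\<And>i r. r \<in> {s..t} \<Longrightarrow> i \<in> U \<Longrightarrow> \<kappa> i r \<le> C"
    and i: "i \<in> U"
  shows "c * exp (- C * (t - s)) \<le> \<xi> i t"
proof -
  define m where "m r = c * exp (- C * (r - s))" for r
  \<comment> \<open>The comparison runs over all indices; outside \<open>U\<close> both
    \<open>v\<close> and its rate are set to 0.\<close>
  define v where "v i r = (if i \<in> U then m r - \<xi> i r else 0)" for i r
  define g' where "g' i r = (if i \<in> U then - C * m r - g i r else 0)" for i r
  have m0: "0 \<le> m r" for r using c by (simp add: m_def)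
  have dm: "((\<lambda>r. - C * m r) has_integral m r - m s) {s..r}" if "s \<le> r" for r
    unfolding m_def
    by (rule fundamental_theorem_of_calculus[OF that])
      (auto intro!: derivative_eq_intros simp flip: has_real_derivative_iff_has_vector_derivative)
  have "v i t \<le> 0"
  proof (rule integral_comparison[where v = v and g = g' and K = ahi and s = s and t = t])
    show "(g' i has_integral v i r - v i s) {s..r}" if r: "r \<in> {s..t}" for i r
    proof (cases "i \<in> U")
      case True
      have "((\<lambda>r. - C * m r - g i r) has_integral (m r - m s) - (\<xi> i r - \<xi> i s)) {s..r}"
        by (intro has_integral_diff dm I) (use r in auto)
      then show ?thesis using True by (simp add: g'_def[abs_def] v_def algebra_simps)
    qed (simp add: g'_def[abs_def] v_def)
    show "v i s \<le> 0" for i using init by (simp add: v_def m_def)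
    fix i r assume r: "r \<in> {s..t}" and v0: "0 \<le> v i r"
    show "g' i r \<le> ahi * (\<Sum>j\<in>UNIV. max 0 (v j r))"
    proof (cases "i \<in> U")
      case True
      have \<xi>m: "\<xi> i r \<le> m r" using v0 True by (simp add: v_def)
      have "\<kappa> i r * \<xi> i r \<le> C * m r"
        using \<kappa>[OF r True] \<xi>0[OF r, of i] \<xi>m C m0[of r] by (intro mult_mono) auto
      moreover have "- (\<Sum>j\<in>N i r. \<alpha> i j r * (\<xi> j r - \<xi> i r)) \<le> ahi * (\<Sum>j\<in>N i r. max 0 (v j r))"
        unfolding sum_negf[symmetric] sum_distrib_left
      proof (rule sum_mono)
        fix j assume "j \<in> N i r"
        then have "\<xi> i r - \<xi> j r \<le> max 0 (v j r)"
          using N[OF r True] v0 True by (auto simp: v_def)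
        then have "\<alpha> i j r * (\<xi> i r - \<xi> j r) \<le> \<alpha> i j r * max 0 (v j r)"
          using \<alpha>[of i j r] by (intro mult_left_mono) auto
        also have "\<dots> \<le> ahi * max 0 (v j r)"
          using \<alpha>[of i j r] by (intro mult_right_mono) auto
        finally show "- (\<alpha> i j r * (\<xi> j r - \<xi> i r)) \<le> ahi * max 0 (v j r)"
          by (simp add: algebra_simps)
      qed
      moreover have "ahi * (\<Sum>j\<in>N i r. max 0 (v j r)) \<le> ahi * (\<Sum>j\<in>UNIV. max 0 (v j r))"
        by (intro mult_left_mono ahi sum_mono2) auto
      ultimately show ?thesis using True by (simp add: g'_def g[OF r])
    next
      case False
      then show ?thesis using ahi by (simp add: g'_def sum_nonneg)
    qed
  qed (use ahi st in auto)
  then show ?thesis using i by (simp add: v_def m_def)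
qed

definition clip :: "real \<Rightarrow> real" where "clip q = max 0 (min 1 q)"

lemma continuous_on_clip [continuous_intros]:
  "continuous_on S f \<Longrightarrow> continuous_on S (\<lambda>x. clip (f x))"
  unfolding clip_def by (intro continuous_intros)

text \<open>With all leaders resting at the origin and all followers on the ray of \<open>e\<close>, the system
  becomes scalar. Clipping the coordinates to \<open>[0, 1]\<close>, an invariant interval, makes the right-hand
  side bounded on bounded time intervals although \<open>b\<close> need not be bounded.\<close>
lemma ray_solution:
  fixes sg :: "real \<Rightarrow> ('f::finite + 'l::finite) rel"
    and a :: "'f \<Rightarrow> 'f \<Rightarrow> (real^'d::finite)^'f \<Rightarrow> (real^'d)^'l \<Rightarrow> real \<Rightarrow> real"
    and b :: "'f \<Rightarrow> 'l \<Rightarrow> (real^'d)^'f \<Rightarrow> (real^'d)^'l \<Rightarrow> real \<Rightarrow> real"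
    and e :: "real^'d"
  assumes sig: "dwell_signal P tauD sg"
    and a_cont: "\<forall>i j. continuous_on UNIV (\<lambda>(x, y, t). a i j x y t)"
    and b_cont: "\<forall>i j. continuous_on UNIV (\<lambda>(x, y, t). b i j x y t)"
    and a0: "\<And>i j x y t. 0 \<le> a i j x y t"
    and b0: "\<And>i j x y t. 0 \<le> b i j x y t"
  obtains \<xi> :: "real \<Rightarrow> real^'f" where "\<xi> 0 = 1" "\<And>t i. 0 \<le> t \<Longrightarrow> \<xi> t $ i \<in> {0..1}"
    "is_solution sg a b (\<lambda>_ _ _. 0) (\<lambda>_ _. 0) (\<lambda>t. \<chi> i. \<xi> t $ i *\<^sub>R e) (\<lambda>_. 0)"
    "\<And>t i. 0 \<le> t \<Longrightarrow> ((\<lambda>s. (\<Sum>j\<in>Nbr (sg s) i. a i j (\<chi> i. \<xi> s $ i *\<^sub>R e) 0 s * (\<xi> s $ j - \<xi> s $ i))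
      - (\<Sum>j\<in>LNbr (sg s) i. b i j (\<chi> i. \<xi> s $ i *\<^sub>R e) 0 s) * \<xi> s $ i) has_integral \<xi> t $ i - 1) {0..t}"
proof -
  define L where "L q = (\<chi> i. q $ i *\<^sub>R e)" for q :: "real^'f"
  have "linear L" by (rule linearI) (simp_all add: L_def vec_eq_iff algebra_simps)
  then have bL: "bounded_linear L" by (rule linear_conv_bounded_linear[THEN iffD1])
  define Cl where "Cl q = (\<chi> i. clip (q $ i))" for q :: "real^'f"
  define H where "H G s q = (\<chi> i.
      (\<Sum>j\<in>Nbr G i. a i j (L (Cl q)) 0 s * (clip (q $ j) - clip (q $ i)))
      - (\<Sum>j\<in>LNbr G i. b i j (L (Cl q)) 0 s) * clip (q $ i))" for G :: "('f + 'l) rel" and s and q :: "real^'f"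
  define F where "F s q = H (sg s) s q" for s q
  have cCl: "continuous_on UNIV Cl"
    unfolding Cl_def by (intro continuous_intros continuous_on_vec_lambda)
  have cL: "continuous_on S L" for S by (rule linear_continuous_on[OF bL])
  have arg: "continuous_on S (\<lambda>p. (L (Cl (snd p)), 0 :: (real^'d)^'l, fst p :: real))" for S
    by (intro continuous_intros continuous_on_compose2[OF cL] continuous_on_compose2[OF cCl]) auto
  have ca: "continuous_on S (\<lambda>p. a i j (L (Cl (snd p))) 0 (fst p))" for S i j
    using continuous_on_compose2[OF a_cont[rule_format, of i j] arg[of S]] by simp
  have cb: "continuous_on S (\<lambda>p. b i j (L (Cl (snd p))) 0 (fst p))" for S i j
    using continuous_on_compose2[OF b_cont[rule_format, of i j] arg[of S]] by simp
  have cH: "continuous_on S (\<lambda>p. H G (fst p) (snd p))" for G and S :: "(real \<times> (real^'f)) set"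
    unfolding H_def by (intro continuous_on_vec_lambda continuous_intros ca cb)
  have H_Cl: "H G s (Cl q) = H G s q" for G s q
    by (simp add: H_def Cl_def clip_def)
  \<comment> \<open>Clipping lets the state range over a compact cube, so continuity bounds the
    right-hand side on each unit time interval, for all of the finitely many digraphs at
    once.\<close>
  have "\<exists>M. \<forall>G. \<forall>s\<in>{real n..real (Suc n)}. \<forall>q. norm (H G s q) \<le> M" for n
  proof -
    define K where "K = {real n..real (Suc n)} \<times> cbox (0::real^'f) 1"
    have "compact K" unfolding K_def by (intro compact_Times) auto
    then have "compact (\<Union>G\<in>UNIV. (\<lambda>p. H G (fst p) (snd p)) ` K)"
      by (intro compact_UN compact_continuous_image cH) auto
    then have "bounded (\<Union>G\<in>UNIV. (\<lambda>p. H G (fst p) (snd p)) ` K)" by (rule compact_imp_bounded)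
    then obtain M where M: "\<forall>q\<in>\<Union>G\<in>UNIV. (\<lambda>p. H G (fst p) (snd p)) ` K. norm q \<le> M"
      unfolding bounded_iff ..
    have "norm (H G s q) \<le> M" if "s \<in> {real n..real (Suc n)}" for G s q
    proof -
      have "(s, Cl q) \<in> K" using that by (auto simp: K_def mem_box_cart Cl_def clip_def)
      then have "H G s (Cl q) \<in> (\<Union>G\<in>UNIV. (\<lambda>p. H G (fst p) (snd p)) ` K)" by force
      then have "norm (H G s (Cl q)) \<le> M" using M by blast
      then show ?thesis by (simp add: H_Cl)
    qed
    then show ?thesis by blast
  qed
  then obtain M where M: "\<And>n G s q. s \<in> {real n..real (Suc n)} \<Longrightarrow> norm (H G s q) \<le> M n"
    by metis
  have Fabs: "(\<lambda>s. F s (c s)) absolutely_integrable_on {r..t}"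
    if "continuous_on {r..t} c" "0 \<le> r" for c r t
    unfolding F_def
  proof (rule switched_absolutely_integrable[OF sig _ that(2)])
    fix G
    have "continuous_on {r..t} (\<lambda>s. (s, c s))" using that by (intro continuous_intros)
    then show "continuous_on {r..t} (\<lambda>s. H G s (c s))"
      using continuous_on_compose2[OF cH[of UNIV G]] by fastforce
  qed
  obtain \<xi> where \<xi>0: "\<xi> 0 = 1"
    and \<xi>: "\<And>t. 0 \<le> t \<Longrightarrow> ((\<lambda>s. F s (\<xi> s)) has_integral \<xi> t - 1) {0..t}"
  proof (rule peano_caratheodory_global[of F M 1])
    show "norm (F s q) \<le> M n" if "s \<in> {real n..real (Suc n)}" for n s q
      using M[OF that] by (simp add: F_def)
    show "continuous_on UNIV (F s)" for s
      unfolding F_def[abs_def]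
      using continuous_on_compose2[OF cH[of UNIV "sg s"], of UNIV "\<lambda>q. (s, q)"]
      by (simp add: continuous_on_Pair)
    show "(\<lambda>s. F s (c s)) integrable_on {r..t}" if "continuous_on UNIV c" "0 \<le> r" for c r t
      using Fabs[of r t c] that continuous_on_subset set_lebesgue_integral_eq_integral(1) by blast
  qed blast
  have c\<xi>: "continuous_on {0..t} \<xi>" for t
    by (rule continuous_on_of_has_integral[where g = "\<lambda>s. F s (\<xi> s)"]) (use \<xi> \<xi>0 in auto)
  have coord: "((\<lambda>s. F s (\<xi> s) $ i) has_integral \<xi> t $ i - 1) {0..t}" if "0 \<le> t" for t i
    using has_integral_linear[OF \<xi>[OF that] bounded_linear_vec_nth[of i]] by (simp add: o_def)
  have F_nth: "F s q $ i = (\<Sum>j\<in>Nbr (sg s) i. a i j (L (Cl q)) 0 s * (clip (q $ j) - clip (q $ i)))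
      - (\<Sum>j\<in>LNbr (sg s) i. b i j (L (Cl q)) 0 s) * clip (q $ i)" for s q i
    by (simp add: F_def H_def)
  \<comment> \<open>Where a coordinate is at most 0 its clipped value is 0, so its rate is
    nonnegative; the comparison then applies with \<open>K = 0\<close>. The upper bound
    \<open>le1\<close> is symmetric, as clipped neighbours never exceed 1.\<close>
  have ge0: "0 \<le> \<xi> t $ i" if t: "0 \<le> t" for t i
  proof -
    have "- \<xi> t $ i \<le> 0"
    proof (rule integral_comparison[where v = "\<lambda>i t. - \<xi> t $ i" and g = "\<lambda>i s. - F s (\<xi> s) $ i"
          and K = 0 and s = 0 and t = t and i = i])
      show "((\<lambda>s. - F s (\<xi> s) $ i) has_integral - \<xi> r $ i - - \<xi> 0 $ i) {0..r}" if "r \<in> {0..t}" for i r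
        using has_integral_neg[OF coord[of r i]] that by (simp add: \<xi>0)
      fix i r assume "r \<in> {0..t}" "0 \<le> - \<xi> r $ i"
      then have "clip (\<xi> r $ i) = 0" by (simp add: clip_def)
      then show "- F r (\<xi> r) $ i \<le> 0 * (\<Sum>j\<in>UNIV. max 0 (- \<xi> r $ j))"
        by (simp add: F_nth sum_nonneg a0 clip_def)
    qed (use t in \<open>auto simp: \<xi>0\<close>)
    then show ?thesis by simp
  qed
  have le1: "\<xi> t $ i \<le> 1" if t: "0 \<le> t" for t i
  proof -
    have "\<xi> t $ i - 1 \<le> 0"
    proof (rule integral_comparison[where v = "\<lambda>i t. \<xi> t $ i - 1" and g = "\<lambda>i s. F s (\<xi> s) $ i"
          and K = 0 and s = 0 and t = t and i = i])
      show "((\<lambda>s. F s (\<xi> s) $ i) has_integral \<xi> r $ i - 1 - (\<xi> 0 $ i - 1)) {0..r}" if "r \<in> {0..t}" for i r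
        using coord[of r i] that by (simp add: \<xi>0)
      fix i r assume "r \<in> {0..t}" "0 \<le> \<xi> r $ i - 1"
      then have "clip (\<xi> r $ i) = 1" by (simp add: clip_def)
      moreover have "(\<Sum>j\<in>Nbr (sg r) i. a i j (L (Cl (\<xi> r))) 0 r * (clip (\<xi> r $ j) - 1)) \<le> 0"
        by (intro sum_nonpos mult_nonneg_nonpos a0) (simp add: clip_def)
      moreover have "0 \<le> (\<Sum>j\<in>LNbr (sg r) i. b i j (L (Cl (\<xi> r))) 0 r)"
        by (intro sum_nonneg b0)
      ultimately show "F r (\<xi> r) $ i \<le> 0 * (\<Sum>j\<in>UNIV. max 0 (\<xi> r $ j - 1))"
        by (simp add: F_nth)
    qed (use t in \<open>auto simp: \<xi>0\<close>)
    then show ?thesis by simp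
  qed
  have clip\<xi>: "clip (\<xi> t $ i) = \<xi> t $ i" if "0 \<le> t" for t i
    using ge0[OF that, of i] le1[OF that, of i] by (simp add: clip_def)
  have F_\<xi>: "F s (\<xi> s) $ i = (\<Sum>j\<in>Nbr (sg s) i. a i j (L (\<xi> s)) 0 s * (\<xi> s $ j - \<xi> s $ i))
      - (\<Sum>j\<in>LNbr (sg s) i. b i j (L (\<xi> s)) 0 s) * \<xi> s $ i" if "0 \<le> s" for s i
  proof -
    have "Cl (\<xi> s) = \<xi> s" by (simp add: Cl_def clip\<xi>[OF that] vec_eq_iff)
    then show ?thesis by (simp add: F_nth clip\<xi>[OF that])
  qed
  have rhs: "follower_rhs sg a b (\<lambda>_ _. 0) (\<lambda>t. L (\<xi> t)) (\<lambda>_. 0) s = L (F s (\<xi> s))" if "0 \<le> s" for s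
  proof (subst vec_eq_iff, rule allI)
    fix i
    have "L (F s (\<xi> s)) $ i = F s (\<xi> s) $ i *\<^sub>R e" by (simp add: L_def)
    also have "\<dots> = (\<Sum>j\<in>Nbr (sg s) i. a i j (L (\<xi> s)) 0 s *\<^sub>R (L (\<xi> s) $ j - L (\<xi> s) $ i))
        + (\<Sum>j\<in>LNbr (sg s) i. b i j (L (\<xi> s)) 0 s *\<^sub>R (0 - L (\<xi> s) $ i))"
      by (simp add: F_\<xi>[OF that] L_def scaleR_sum_left sum_distrib_right sum_negf scaleR_diff_left scaleR_diff_right
          right_diff_distrib)
    finally show "follower_rhs sg a b (\<lambda>_ _. 0) (\<lambda>t. L (\<xi> t)) (\<lambda>_. 0) s $ i = L (F s (\<xi> s)) $ i"
      by (simp add: follower_rhs_def)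
  qed
  have "is_solution sg a b (\<lambda>_ _ _. 0) (\<lambda>_ _. 0) (\<lambda>t. L (\<xi> t)) (\<lambda>_. 0)"
    unfolding is_solution_def
  proof (intro allI impI conjI)
    fix t :: real assume t: "0 \<le> t"
    have z: "leader_rhs (\<lambda>_ _ _. 0) (\<lambda>_. 0 :: (real^'d)^'l) = (\<lambda>_. 0)"
      by (simp add: leader_rhs_def fun_eq_iff vec_eq_iff)
    show "leader_rhs (\<lambda>_ _ _. 0) (\<lambda>_. 0 :: (real^'d)^'l) absolutely_integrable_on {0..t}"
      "integral {0..t} (leader_rhs (\<lambda>_ _ _. 0) (\<lambda>_. 0 :: (real^'d)^'l)) = 0 - 0"
      unfolding z by simp_all
    have "(L \<circ> (\<lambda>s. F s (\<xi> s))) absolutely_integrable_on {0..t}"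
      by (intro absolutely_integrable_linear Fabs c\<xi> bL) simp
    then show "follower_rhs sg a b (\<lambda>_ _. 0) (\<lambda>t. L (\<xi> t)) (\<lambda>_. 0) absolutely_integrable_on {0..t}"
      by (subst set_integrable_cong[OF refl refl rhs]) (auto simp: o_def)
    have "((\<lambda>s. L (F s (\<xi> s))) has_integral L (\<xi> t - 1)) {0..t}"
      using has_integral_linear[OF \<xi>[OF t] bL] by (simp add: o_def)
    then have "(follower_rhs sg a b (\<lambda>_ _. 0) (\<lambda>t. L (\<xi> t)) (\<lambda>_. 0) has_integral L (\<xi> t - 1)) {0..t}"
      by (rule has_integral_eq[rotated]) (simp add: rhs)
    then show "integral {0..t} (follower_rhs sg a b (\<lambda>_ _. 0) (\<lambda>t. L (\<xi> t)) (\<lambda>_. 0)) = L (\<xi> t) - L (\<xi> 0)"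
      by (simp add: integral_unique \<xi>0 linear_diff[OF \<open>linear L\<close>])
  qed
  moreover have "((\<lambda>s. (\<Sum>j\<in>Nbr (sg s) i. a i j (L (\<xi> s)) 0 s * (\<xi> s $ j - \<xi> s $ i))
      - (\<Sum>j\<in>LNbr (sg s) i. b i j (L (\<xi> s)) 0 s) * \<xi> s $ i) has_integral \<xi> t $ i - 1) {0..t}"
    if "0 \<le> t" for t i
    by (rule has_integral_eq[OF _ coord[OF that]]) (simp add: F_\<xi>)
  ultimately show thesis
    using that[of \<xi>] \<xi>0 ge0 le1 unfolding L_def by simp
qed

lemma SiISS_imp_JLC:
  fixes sg :: "real \<Rightarrow> ('f::finite + 'l::finite) rel"
    and a :: "'f \<Rightarrow> 'f \<Rightarrow> (real^'d::finite)^'f \<Rightarrow> (real^'d)^'l \<Rightarrow> real \<Rightarrow> real"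
    and b :: "'f \<Rightarrow> 'l \<Rightarrow> (real^'d)^'f \<Rightarrow> (real^'d)^'l \<Rightarrow> real \<Rightarrow> real"
  assumes sig: "dwell_signal P tauD sg"
    and a_cont: "\<forall>i j. continuous_on UNIV (\<lambda>(x, y, t). a i j x y t)"
    and b_cont: "\<forall>i j. continuous_on UNIV (\<lambda>(x, y, t). b i j x y t)"
    and a: "\<And>i j x y t. 0 \<le> a i j x y t \<and> a i j x y t \<le> ahi"
    and b0: "\<And>i j x y t. 0 \<le> b i j x y t"
    and siiss: "SiISS sg a b"
  shows "JLC sg"
proof (rule ccontr)
  assume "\<not> JLC sg"
  then obtain t0 where t0: "0 \<le> t0" and nc: "\<not> L_connected (joint_graph sg {t0..})"
    by (auto simp: JLC_def)
  \<comment> \<open>From \<open>t0\<close> on no arc enters \<open>U\<close> from a leader or from a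
    follower outside \<open>U\<close>, since it would extend a path from a leader into
    \<open>U\<close>.\<close>
  define U where "U = {i. \<forall>j. (Inr j, Inl i) \<notin> (joint_graph sg {t0..})\<^sup>+}"
  obtain i0 where i0: "i0 \<in> U" using nc by (auto simp: L_connected_def U_def)
  have U_N: "Nbr (sg r) i \<subseteq> U" if "i \<in> U" "t0 \<le> r" for i r
  proof
    fix k assume "k \<in> Nbr (sg r) i"
    then have "(Inl k, Inl i) \<in> joint_graph sg {t0..}"
      using that by (auto simp: Nbr_def joint_graph_def)
    then show "k \<in> U" using that(1) by (auto simp: U_def dest: trancl_into_trancl)
  qed
  have U_L: "LNbr (sg r) i = {}" if "i \<in> U" "t0 \<le> r" for i r
    using that by (force simp: U_def LNbr_def joint_graph_def)
  \<comment> \<open>The coordinate is unspecified; any unit vector serves.\<close>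
  define e :: "real^'d" where "e = axis undefined 1"
  have e: "norm e = 1" by (simp add: e_def norm_axis_1)
  obtain \<xi> :: "real \<Rightarrow> real^'f" where \<xi>0: "\<xi> 0 = 1" and \<xi>01: "\<And>t i. 0 \<le> t \<Longrightarrow> \<xi> t $ i \<in> {0..1}"
    and sol: "is_solution sg a b (\<lambda>_ _ _. 0) (\<lambda>_ _. 0) (\<lambda>t. \<chi> i. \<xi> t $ i *\<^sub>R e) (\<lambda>_. 0)"
    and ode: "\<And>t i. 0 \<le> t \<Longrightarrow> ((\<lambda>s. (\<Sum>j\<in>Nbr (sg s) i. a i j (\<chi> i. \<xi> s $ i *\<^sub>R e) 0 s * (\<xi> s $ j - \<xi> s $ i))
      - (\<Sum>j\<in>LNbr (sg s) i. b i j (\<chi> i. \<xi> s $ i *\<^sub>R e) 0 s) * \<xi> s $ i) has_integral \<xi> t $ i - 1) {0..t}"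
    using ray_solution[OF sig a_cont b_cont conjunct1[OF a] b0] by blast
  define x where "x t = (\<chi> i. \<xi> t $ i *\<^sub>R e)" for t
  define \<kappa> where "\<kappa> i s = (\<Sum>j\<in>LNbr (sg s) i. b i j (x s) 0 s)" for i s
  define g where "g i s = (\<Sum>j\<in>Nbr (sg s) i. a i j (x s) 0 s * (\<xi> s $ j - \<xi> s $ i)) - \<kappa> i s * \<xi> s $ i" for i s
  have g: "(g i has_integral \<xi> t $ i - \<xi> 0 $ i) {0..t}" if "0 \<le> t" for i t
    using ode[OF that, of i] unfolding g_def \<kappa>_def x_def by (simp add: \<xi>0)
  have c\<xi>: "continuous_on {0..t0} (\<lambda>s. \<xi> s $ i)" for i
    by (rule continuous_on_of_has_integral[where g = "g i"]) (use g in auto)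
  have cx: "continuous_on {0..t0} x"
    unfolding x_def by (intro continuous_on_vec_lambda continuous_intros c\<xi>)
  have "continuous_on {0..t0} (\<lambda>s. b i j (x s) 0 s)" for i j
    using continuous_on_compose2[OF b_cont[rule_format, of i j], of "{0..t0}" "\<lambda>s. (x s, 0, s)"]
    by (simp add: cx continuous_on_Pair)
  \<comment> \<open>The leader weights have no upper bound in the assumptions; along this one
    solution they are bounded on \<open>[0, t0]\<close> by continuity.\<close>
  then have "compact ((\<lambda>s. \<Sum>i\<in>UNIV. \<Sum>j\<in>UNIV. b i j (x s) 0 s) ` {0..t0})"
    by (intro compact_continuous_image continuous_intros) auto
  then have "bdd_above ((\<lambda>s. \<Sum>i\<in>UNIV. \<Sum>j\<in>UNIV. b i j (x s) 0 s) ` {0..t0})"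
    by (intro bounded_imp_bdd_above compact_imp_bounded)
  then obtain C where C: "\<And>s. s \<in> {0..t0} \<Longrightarrow> (\<Sum>i\<in>UNIV. \<Sum>j\<in>UNIV. b i j (x s) 0 s) \<le> C"
    unfolding bdd_above_def by blast
  have \<kappa>C: "\<kappa> i s \<le> C" if "s \<in> {0..t0}" for i s
  proof -
    have "\<kappa> i s \<le> (\<Sum>j\<in>UNIV. b i j (x s) 0 s)"
      unfolding \<kappa>_def by (intro sum_mono2 b0) auto
    also have "\<dots> \<le> (\<Sum>i\<in>UNIV. \<Sum>j\<in>UNIV. b i j (x s) 0 s)"
      by (rule member_le_sum) (auto intro!: sum_nonneg b0)
    finally show ?thesis using C[OF that] by linarith
  qed
  have C0: "0 \<le> C"
    using order_trans[OF _ C[of 0]] t0 by (force intro!: sum_nonneg b0)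
  have ahi: "0 \<le> ahi" using a order_trans by blast
  define \<delta> where "\<delta> = exp (- C * t0)"
  have at_t0: "\<delta> \<le> \<xi> t0 $ i" for i
    using decay_lower_bound[where ahi = ahi and C = C and c = 1 and s = 0 and t = t0 and g = g and U = UNIV
        and \<xi> = "\<lambda>i t. \<xi> t $ i" and N = "\<lambda>i s. Nbr (sg s) i" and \<alpha> = "\<lambda>i j s. a i j (x s) 0 s" and \<kappa> = \<kappa> and i = i]
      ahi C0 t0 g \<xi>01 a \<kappa>C by (auto simp: \<delta>_def \<xi>0 g_def)
  have later: "\<delta> \<le> \<xi> t $ i0" if t: "t0 \<le> t" for t
  proof -
    have "\<delta> * exp (- 0 * (t - t0)) \<le> \<xi> t $ i0"
    proof (rule decay_lower_bound[where ahi = ahi and C = 0 and g = g and U = U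
        and \<xi> = "\<lambda>i t. \<xi> t $ i" and N = "\<lambda>i s. Nbr (sg s) i" and \<alpha> = "\<lambda>i j s. a i j (x s) 0 s" and \<kappa> = \<kappa>])
      show "(g i has_integral \<xi> r $ i - \<xi> t0 $ i) {t0..r}" if "r \<in> {t0..t}" for i r
        using has_integral_Icc_diff[OF g[of r i] g[of t0 i]] that t0 by simp
      show "\<kappa> i r \<le> 0" if "r \<in> {t0..t}" "i \<in> U" for i r
        using U_L[of i r] that by (simp add: \<kappa>_def)
    qed (use ahi t t0 \<xi>01 at_t0 a i0 U_N in \<open>auto simp: \<delta>_def g_def\<close>)
    then show ?thesis by simp
  qed
  obtain \<beta> \<gamma> where \<beta>: "class_KL \<beta>" and \<gamma>: "class_K \<gamma>"
    and est_all: "\<forall>u w x y. admissible u w \<longrightarrow> is_solution sg a b u w x y \<longrightarrow> (\<forall>t\<ge>0.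
      ennreal (dist_hull (x t) (y t)) \<le> ennreal (\<beta> (dist_hull (x 0) (y 0)) t) +
      (\<integral>\<^sup>+ s\<in>{0..t}. ennreal (\<gamma> (norm (input_signal u w y s))) \<partial>lborel))"
    using siiss unfolding SiISS_def by (elim exE conjE) (rule that)
  have est: "ennreal (dist_hull (x t) (y t)) \<le> ennreal (\<beta> (dist_hull (x 0) (y 0)) t) +
      (\<integral>\<^sup>+ s\<in>{0..t}. ennreal (\<gamma> (norm (input_signal u w y s))) \<partial>lborel)"
    if "admissible u w" "is_solution sg a b u w x y" "0 \<le> t" for u w x y t
    using est_all[rule_format, OF that] .
  define D0 where "D0 = dist_hull (x 0) (0 :: (real^'d)^'l)"
  have dist: "norm (xv $ i) \<le> dist_hull xv (0 :: (real^'d)^'l)" for xv :: "(real^'d)^'f" and i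
  proof -
    have "range (\<lambda>j. (0 :: (real^'d)^'l) $ j) = {0}" by auto
    then have "leader_hull (0 :: (real^'d)^'l) = {0}" by (simp add: leader_hull_def)
    then have "norm (xv $ i) = infdist (xv $ i) (leader_hull (0 :: (real^'d)^'l))"
      by (simp add: dist_norm)
    also have "\<dots> \<le> dist_hull xv (0 :: (real^'d)^'l)" unfolding dist_hull_def by (rule Max_ge) auto
    finally show ?thesis .
  qed
  have D0: "0 \<le> D0" unfolding D0_def using dist norm_ge_zero order_trans by blast
  have adm: "admissible (\<lambda>_ _ _. 0 :: real^'d) (\<lambda>_ _. 0 :: real^'d)"
    unfolding admissible_def pw_continuous_def by (auto intro!: exI[of _ "{}"])
  have "\<delta> \<le> \<beta> D0 t" if t: "t0 \<le> t" for t
  proof -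
    have zero: "input_signal (\<lambda>_ _ _. 0) (\<lambda>_ _. 0) (\<lambda>_. 0) s = (0 :: ((real^'d)^'l) \<times> ((real^'d)^'f))" for s
      by (simp add: input_signal_def leader_rhs_def vec_eq_iff zero_prod_def)
    have "\<delta> \<le> norm (x t $ i0)" using later[OF t] e by (simp add: x_def)
    also have "\<dots> \<le> dist_hull (x t) (0 :: (real^'d)^'l)" by (rule dist)
    finally have "ennreal \<delta> \<le> ennreal (dist_hull (x t) (0 :: (real^'d)^'l))" by (rule ennreal_leI)
    \<comment> \<open>For zero input the integrand is \<open>\<gamma> 0 = 0\<close>, so only the
      class-KL term remains.\<close>
    also have "\<dots> \<le> ennreal (\<beta> D0 t)"
      using est[OF adm sol[folded x_def], of t] t t0 \<gamma> unfolding zero D0_def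
      by (simp add: class_K_def)
    finally have "ennreal \<delta> \<le> ennreal (\<beta> D0 t)" .
    moreover have "0 < \<delta>" by (simp add: \<delta>_def)
    ultimately show ?thesis by (metis ennreal_le_iff2 less_le_not_le linorder_not_le)
  qed
  moreover have "\<forall>\<^sub>F t in at_top. \<beta> D0 t < \<delta>"
    using \<beta> D0 by (intro order_tendstoD(2)[of _ 0]) (auto simp: class_KL_def \<delta>_def)
  then obtain T where "\<And>t. T \<le> t \<Longrightarrow> \<beta> D0 t < \<delta>" by (auto simp: eventually_at_top_linorder)
  ultimately show False by (metis linorder_not_le max.cobounded1 max.cobounded2)
qed

theorem theorem3:
  fixes P :: "('f::finite + 'l::finite) rel set"
    and tauD :: real
    and sg :: "real \<Rightarrow> ('f + 'l) rel"
    and a :: "'f \<Rightarrow> 'f \<Rightarrow> (real^'d::finite)^'f \<Rightarrow> (real^'d)^'l \<Rightarrow> real \<Rightarrow> real"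
    and b :: "'f \<Rightarrow> 'l \<Rightarrow> (real^'d)^'f \<Rightarrow> (real^'d)^'l \<Rightarrow> real \<Rightarrow> real"
    and a_lo a_hi b_lo :: real
  assumes n2: "CARD('f) \<ge> 2"
    and finP: "finite P"
    and P_ok: "\<forall>G\<in>P. no_arc_into_leader G"
    and sig: "dwell_signal P tauD sg"
    and a_cont: "\<forall>i j. continuous_on UNIV (\<lambda>(x, y, t). a i j x y t)"
    and b_cont: "\<forall>i j. continuous_on UNIV (\<lambda>(x, y, t). b i j x y t)"
    and a_pos: "0 < a_lo" and a_le: "a_lo \<le> a_hi"
    and a_bnd: "\<forall>i j x y t. a_lo \<le> a i j x y t \<and> a i j x y t \<le> a_hi"
    and b_pos: "0 < b_lo"
    and b_bnd: "\<forall>i j x y t. b_lo \<le> b i j x y t"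
    and bidir: "follower_bidirectional sg"
  shows "SiISS sg a b \<longleftrightarrow> JLC sg"
proof
  have a0: "0 \<le> a i j x y t \<and> a i j x y t \<le> a_hi" for i j x y t
    using a_bnd a_pos by (meson less_imp_le order_trans)
  have b0: "0 \<le> b i j x y t" for i j x y t
    using b_bnd b_pos by (meson less_imp_le order_trans)
  show "JLC sg" if "SiISS sg a b"
    by (rule SiISS_imp_JLC[OF sig a_cont b_cont a0 b0 that])
  show "SiISS sg a b" if "JLC sg"
    using JLC_imp_SiISS[OF sig bidir a_pos a_le _ b_pos _ that] a_bnd b_bnd by blast
qed

end
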